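(* Let $D\subset\mathbb C^n$ be a $\mathcal C^1$-smooth open set having a $\mathcal C^2$-smooth non-pseudoconvex boundary point. If the set of non $\mathcal C^2$-smooth boundary points of $D$ has zero $(2n-2)$-dimensional Hausdorff measure, then $D$ has no exceptional points.
   Context: For $k\in\{1,2\}$, a boundary point $b\in\partial D$ is $\mathcal C^k$-smooth if on some neighborhood $U$ of $b$ there is a real-valued $\mathcal C^k$ function $r$ with non-vanishing gradient on $\partial D\cap U$ such that $D\cap U=\{z\in U:r(z)<0\}$ and $\partial D\cap U=\{z\in U:r(z)=0\}$ (a $\mathcal C^k$ defining function). $D$ is $\mathcal C^k$-smooth if all its boundary points are $\mathcal C^k$-smooth. A $\mathcal C^2$-smooth boundary point $b$ is non-pseudoconvex if there is a complex tangent vector $X\in\mathbb C^n$, i.e. $\sum_j\frac{\partial r}{\partial z_j}(b)X_j=0$, such that the Levi form $\sum_{j,k}\frac{\partial^2 r}{\partial z_j\partial\overline z_k}(b)X_j\overline{X_k}$ is negative. A two-dimensional plane in $\mathbb C^n$ is a complex affine subspace of complex dimension $2$. A point $a\in\mathbb C^n$ is an exceptional point for $D$ if for every two-dimensional plane $P\ni a$, the set $P\cap D$ is empty or pseudoconvex (as an open subset of $P\cong\mathbb C^2$). *)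

theory Defs
  imports "HOL-Analysis.Analysis"
begin

section \<open>Smooth boundary points\<close>

definition C1_on :: "('a::real_normed_vector \<Rightarrow> 'b::real_normed_vector) \<Rightarrow> 'a set \<Rightarrow> bool"
  where "C1_on f U \<longleftrightarrow>
    (\<exists>f'. (\<forall>x\<in>U. (f has_derivative blinfun_apply (f' x)) (at x)) \<and> continuous_on U f')"

definition C2_on :: "('a::real_normed_vector \<Rightarrow> 'b::real_normed_vector) \<Rightarrow> 'a set \<Rightarrow> bool"
  where "C2_on f U \<longleftrightarrow>
    (\<exists>f'. (\<forall>x\<in>U. (f has_derivative blinfun_apply (f' x)) (at x)) \<and> C1_on f' U)"

text \<open>Regularity of \<open>r\<close> is kept separate, so that the same notion serves for both
  smoothness classes. The gradient is the real one, on \<open>complex ^ 'n\<close> regarded as a real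
  inner product space.\<close>

definition defining_function ::
    "(complex ^ 'n) set \<Rightarrow> (complex ^ 'n) set \<Rightarrow> (complex ^ 'n \<Rightarrow> real) \<Rightarrow> bool"
  where "defining_function D U r \<longleftrightarrow>
    D \<inter> U = {z \<in> U. r z < 0} \<and>
    frontier D \<inter> U = {z \<in> U. r z = 0} \<and>
    (\<forall>z \<in> frontier D \<inter> U. \<exists>g. GDERIV r z :> g \<and> g \<noteq> 0)"

definition C1_defining_function ::
    "(complex ^ 'n) set \<Rightarrow> complex ^ 'n \<Rightarrow> (complex ^ 'n) set \<Rightarrow> (complex ^ 'n \<Rightarrow> real) \<Rightarrow> bool"
  where "C1_defining_function D b U r \<longleftrightarrow>
    open U \<and> b \<in> U \<and> C1_on r U \<and> defining_function D U r"

definition C2_defining_function ::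
    "(complex ^ 'n) set \<Rightarrow> complex ^ 'n \<Rightarrow> (complex ^ 'n) set \<Rightarrow> (complex ^ 'n \<Rightarrow> real) \<Rightarrow> bool"
  where "C2_defining_function D b U r \<longleftrightarrow>
    open U \<and> b \<in> U \<and> C2_on r U \<and> defining_function D U r"

definition C1_smooth_boundary_point :: "(complex ^ 'n) set \<Rightarrow> complex ^ 'n \<Rightarrow> bool"
  where "C1_smooth_boundary_point D b \<longleftrightarrow>
    b \<in> frontier D \<and> (\<exists>U r. C1_defining_function D b U r)"

definition C2_smooth_boundary_point :: "(complex ^ 'n) set \<Rightarrow> complex ^ 'n \<Rightarrow> bool"
  where "C2_smooth_boundary_point D b \<longleftrightarrow>
    b \<in> frontier D \<and> (\<exists>U r. C2_defining_function D b U r)"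

definition C1_smooth :: "(complex ^ 'n) set \<Rightarrow> bool"
  where "C1_smooth D \<longleftrightarrow> (\<forall>b \<in> frontier D. C1_smooth_boundary_point D b)"


section \<open>Levi form\<close>

text \<open>Wirtinger derivatives: \<open>axis j 1\<close> is the direction of the real part of the \<open>j\<close>-th
  coordinate and \<open>axis j \<i>\<close> that of its imaginary part; the Frechet derivative is taken
  over the reals.\<close>

definition wirtinger :: "'n \<Rightarrow> (complex ^ 'n \<Rightarrow> complex) \<Rightarrow> complex ^ 'n \<Rightarrow> complex"
  where "wirtinger j f z =
    (frechet_derivative f (at z) (axis j 1) - \<i> * frechet_derivative f (at z) (axis j \<i>)) / 2"

definition wirtinger_bar :: "'n \<Rightarrow> (complex ^ 'n \<Rightarrow> complex) \<Rightarrow> complex ^ 'n \<Rightarrow> complex"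
  where "wirtinger_bar j f z =
    (frechet_derivative f (at z) (axis j 1) + \<i> * frechet_derivative f (at z) (axis j \<i>)) / 2"

definition complex_tangent :: "(complex ^ 'n \<Rightarrow> real) \<Rightarrow> complex ^ 'n \<Rightarrow> complex ^ 'n \<Rightarrow> bool"
  where "complex_tangent r b X \<longleftrightarrow>
    (\<Sum>j\<in>UNIV. wirtinger j (\<lambda>z. complex_of_real (r z)) b * X $ j) = 0"

definition levi_form :: "(complex ^ 'n \<Rightarrow> real) \<Rightarrow> complex ^ 'n \<Rightarrow> complex ^ 'n \<Rightarrow> complex"
  where "levi_form r b X =
    (\<Sum>j\<in>UNIV. \<Sum>k\<in>UNIV.
       wirtinger j (wirtinger_bar k (\<lambda>z. complex_of_real (r z))) b * X $ j * cnj (X $ k))"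

text \<open>For \<open>r\<close> of class \<open>C\<^sup>2\<close> the matrix of mixed derivatives is Hermitian, so the Levi form
  is real and its sign is that of its real part. The condition below does not depend on the
  choice of the defining function.\<close>

definition non_pseudoconvex_boundary_point :: "(complex ^ 'n) set \<Rightarrow> complex ^ 'n \<Rightarrow> bool"
  where "non_pseudoconvex_boundary_point D b \<longleftrightarrow>
    b \<in> frontier D \<and>
    (\<exists>U r. C2_defining_function D b U r \<and>
       (\<exists>X. complex_tangent r b X \<and> Re (levi_form r b X) < 0))"


section \<open>Pseudoconvex open sets\<close>

text \<open>Plurisubharmonicity of a continuous real-valued function: the sub-mean value inequality
  on the boundary circle of every closed disc \<open>{z + \<tau> w : |\<tau>| \<le> 1}\<close> of a complex line that is
  contained in \<open>\<Omega>\<close>.\<close>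

definition continuous_plurisubharmonic_on ::
    "(complex ^ 'n) set \<Rightarrow> (complex ^ 'n \<Rightarrow> real) \<Rightarrow> bool"
  where "continuous_plurisubharmonic_on \<Omega> u \<longleftrightarrow>
    continuous_on \<Omega> u \<and>
    (\<forall>z w. (\<forall>\<tau>. cmod \<tau> \<le> 1 \<longrightarrow> z + \<tau> *s w \<in> \<Omega>) \<longrightarrow>
       u z \<le> integral {0..2 * pi} (\<lambda>\<theta>. u (z + cis \<theta> *s w)) / (2 * pi))"

text \<open>The definition by a continuous plurisubharmonic exhaustion function (as in Hormander's
  book): all sublevel sets are relatively compact in \<open>\<Omega>\<close>. No connectedness or boundedness
  is required.\<close>

definition pseudoconvex :: "(complex ^ 'n) set \<Rightarrow> bool"
  where "pseudoconvex \<Omega> \<longleftrightarrow>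
    open \<Omega> \<and>
    (\<exists>u. continuous_plurisubharmonic_on \<Omega> u \<and>
       (\<forall>c. \<exists>K. compact K \<and> K \<subseteq> \<Omega> \<and> {z \<in> \<Omega>. u z < c} \<subseteq> K))"


section \<open>Exceptional points\<close>

text \<open>\<open>vec.subspace\<close> and \<open>vec.dim\<close> refer to the complex vector space structure.\<close>

definition complex_plane :: "(complex ^ 'n) set \<Rightarrow> bool"
  where "complex_plane P \<longleftrightarrow> (\<exists>p V. vec.subspace V \<and> vec.dim V = 2 \<and> P = (+) p ` V)"

text \<open>Pseudoconvexity of \<open>P \<inter> D\<close> as an open subset of a plane \<open>P\<close>: complex affine coordinates
  \<open>z \<mapsto> p + A z\<close> identify \<open>complex ^ 2\<close> with \<open>P\<close> (a surjection onto a two-dimensional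
  plane is automatically injective). As pseudoconvexity is invariant under complex affine
  automorphisms, the choice of coordinates is irrelevant.\<close>

definition pseudoconvex_in_plane :: "(complex ^ 'n) set \<Rightarrow> (complex ^ 'n) set \<Rightarrow> bool"
  where "pseudoconvex_in_plane P S \<longleftrightarrow>
    (\<exists>p (A :: complex ^ 2 ^ 'n). range (\<lambda>z. p + A *v z) = P \<and>
       pseudoconvex {z. p + A *v z \<in> S})"

definition exceptional_point :: "(complex ^ 'n) set \<Rightarrow> complex ^ 'n \<Rightarrow> bool"
  where "exceptional_point D a \<longleftrightarrow>
    (\<forall>P. complex_plane P \<and> a \<in> P \<longrightarrow> P \<inter> D = {} \<or> pseudoconvex_in_plane P (P \<inter> D))"


section \<open>Hausdorff measure\<close>

text \<open>The \<open>d\<close>-dimensional Hausdorff outer measure for a natural number \<open>d\<close>, without the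
  normalising constant (the volume of the \<open>d\<close>-dimensional ball of diameter \<open>1\<close>), which does
  not affect null sets. The covering sets are required to be bounded because \<open>diameter\<close>
  is only meaningful there. The empty set is treated separately since \<open>0 ^ 0 = 1\<close>.\<close>

definition hausdorff_premeasure :: "nat \<Rightarrow> real \<Rightarrow> 'a::metric_space set \<Rightarrow> ennreal"
  where "hausdorff_premeasure d \<delta> S =
    (INF C \<in> {C :: nat \<Rightarrow> 'a set. S \<subseteq> (\<Union>i. C i) \<and> (\<forall>i. bounded (C i) \<and> diameter (C i) \<le> \<delta>)}.
       \<Sum>i. (if C i = {} then 0 else ennreal (diameter (C i) ^ d)))"

definition hausdorff_measure :: "nat \<Rightarrow> 'a::metric_space set \<Rightarrow> ennreal"
  where "hausdorff_measure d S = (SUP \<delta>\<in>{0<..}. hausdorff_premeasure d \<delta> S)"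

end

theory Submission
  imports Defs
begin

text \<open>Suppose that \<open>a\<close> is exceptional. Slicing \<open>D\<close> near a boundary point \<open>b\<close> with negative Levi form in
  the tangent direction \<open>X\<close> by the plane through \<open>b\<close> spanned by \<open>X\<close> and \<open>a - b\<close> gives a contradiction
  unless \<open>a - b\<close> is tangent to the boundary. Negativity of the Levi form is an open condition, so near
  \<open>b\<close> the radial field \<open>z - a\<close> is tangent to the boundary, and \<open>D\<close> is locally invariant under
  dilations about \<open>a\<close>. The Levi form only rescales under dilations, so both the negativity and the
  local invariance propagate along the segment from \<open>b\<close> towards \<open>a\<close> as long as it consists of
  \<open>C\<^sup>2\<close>-smooth points. The boundary points whose segment meets the exceptional set
  have empty interior in the boundary, because the union of the corresponding lines, thickened by a
  transversal direction, has measure zero. So for a dense set of boundary points near \<open>b\<close> the whole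
  half-open segment lies in the boundary. Then \<open>a\<close> is a boundary point, and as the boundary is
  \<open>C\<^sup>1\<close> there, all these segments lie in the tangent hyperplane at \<open>a\<close>. Hence
  the boundary is contained in a hyperplane near \<open>b\<close>, which contradicts the negative Levi form.\<close>

section \<open>Second order comparison of boundary germs\<close>

text \<open>The delicate point is the limit along a segment. Each limit point brings its own
  defining function, unrelated to the earlier ones, and negativity of the Levi form could degenerate
  to zero there. What can be transported is the germ of the set \<open>D\<close>. If two germs
  correspond under scaling by \<open>s\<close>, their gradients differ by a factor
  \<open>c > 0\<close>, and on tangent vectors \<open>s * r2'' X X = c * r1'' X X\<close>. The
  quotient of second derivative and gradient is therefore multiplied by \<open>1 / s\<close>, and
  since the scales have a positive limit, its sign survives.

  The dimension of the exceptional set enters through a count of parameters: position on a line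
  through \<open>a\<close> and a transversal shift add two real dimensions to 2n - 2. The swept set
  is thus null for ambient Lebesgue measure, and no surface measure on the boundary has to be
  introduced.

  The point \<open>a\<close> is reached only as a limit of segments. All second order arguments stay
  at positive distance from it, and at \<open>a\<close> itself one gradient is enough.\<close>

lemma second_order_taylor:
  fixes r :: "'a::real_normed_vector \<Rightarrow> real" and r' :: "'a \<Rightarrow> 'a \<Rightarrow>\<^sub>L real" and r'' :: "'a \<Rightarrow>\<^sub>L 'a \<Rightarrow>\<^sub>L real"
  assumes "open U" "b \<in> U" and dr: "\<And>x. x \<in> U \<Longrightarrow> (r has_derivative r' x) (at x)"
    and dr': "(r' has_derivative r'') (at b)" and "0 < e"
  shows "\<exists>d>0. \<forall>v. norm v < d \<longrightarrow>
    b + v \<in> U \<and> \<bar>r (b + v) - r b - r' b v - r'' v v / 2\<bar> \<le> e * (norm v)\<^sup>2"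
proof -
  obtain d0 where d0: "0 < d0" "ball b d0 \<subseteq> U"
    using assms(1,2) open_contains_ball by blast
  obtain d1 where d1: "0 < d1"
    and *: "\<And>y. norm (y - b) < d1 \<Longrightarrow> norm (r' y - r' b - r'' (y - b)) \<le> e * norm (y - b)"
    using dr' \<open>0 < e\<close> unfolding has_derivative_at_alt by blast
  define d where "d = min d0 d1"
  have inU: "b + v \<in> U" if "norm v < d" for v
    using that d0 by (auto simp: d_def dist_norm)
  show ?thesis
  proof (intro exI conjI allI impI)
    show "0 < d" using d0 d1 by (simp add: d_def)
    show "b + v \<in> U" if "norm v < d" for v using inU that .
    fix v :: 'a assume v: "norm v < d"
    \<comment> \<open>Along the segment the derivative of this remainder is \<open>?D v\<close>,
      where \<open>?D\<close> is the first order error of \<open>r'\<close>. Differentiability of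
      \<open>r'\<close> at \<open>b\<close> alone thus gives the quadratic bound.\<close>
    define g where "g t = r (b + t *\<^sub>R v) - t * r' b v - t\<^sup>2 / 2 * r'' v v" for t
    have small: "norm (t *\<^sub>R v) < d" if "t \<in> {0..1}" for t
      using that v by (auto intro: le_less_trans[OF mult_left_le_one_le])
    have "norm (g 1 - g 0) \<le> (e * (norm v)\<^sup>2) * norm (1 - 0::real)"
    proof (rule differentiable_bound)
      show "convex {0..1::real}" by simp
      fix t :: real assume t: "t \<in> {0..1}"
      let ?D = "r' (b + t *\<^sub>R v) - r' b - r'' (t *\<^sub>R v)"
      have dg: "((\<lambda>t. r (b + t *\<^sub>R v)) has_derivative (\<lambda>h. r' (b + t *\<^sub>R v) (h *\<^sub>R v))) (at t)"
        by (rule has_derivative_compose[where f = "\<lambda>t. b + t *\<^sub>R v", OF _ dr[OF inU[OF small[OF t]]]]) (auto intro!: derivative_eq_intros)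
      show "(g has_derivative (\<lambda>h. h * ?D v)) (at t within {0..1})"
        unfolding g_def
        by (rule has_derivative_at_withinI)
          (auto intro!: derivative_eq_intros dg simp: blinfun.bilinear_simps algebra_simps power2_eq_square)
      have "\<bar>?D v\<bar> \<le> norm ?D * norm v" using norm_blinfun[of ?D v] by simp
      also have "\<dots> \<le> (e * norm (t *\<^sub>R v)) * norm v"
        using *[of "b + t *\<^sub>R v"] small[OF t] by (intro mult_right_mono) (auto simp: d_def)
      also have "\<dots> \<le> (e * norm v) * norm v"
        using t \<open>0 < e\<close> by (intro mult_right_mono mult_left_mono) (auto simp: mult_left_le_one_le)
      finally have "\<bar>?D v\<bar> \<le> e * (norm v)\<^sup>2" by (simp add: power2_eq_square algebra_simps)
      then show "onorm (\<lambda>h. h * ?D v) \<le> e * (norm v)\<^sup>2"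
        by (intro onorm_le) (simp add: abs_mult mult.commute mult_left_mono)
    qed simp_all
    then show "\<bar>r (b + v) - r b - r' b v - r'' v v / 2\<bar> \<le> e * (norm v)\<^sup>2"
      by (simp add: g_def algebra_simps)
  qed
qed

text \<open>Parabolas tangent to \<open>X\<close> are the probes for second order information: their
  quadratic part enters through the first derivative, so the choice of \<open>k\<close> decides on
  which side of the boundary they run.\<close>

lemma parabola_expansion:
  fixes r :: "'a::real_normed_vector \<Rightarrow> real" and r' :: "'a \<Rightarrow> 'a \<Rightarrow>\<^sub>L real" and r'' :: "'a \<Rightarrow>\<^sub>L 'a \<Rightarrow>\<^sub>L real"
  assumes "open U" "b \<in> U" and dr: "\<And>x. x \<in> U \<Longrightarrow> (r has_derivative r' x) (at x)"
    and dr': "(r' has_derivative r'') (at b)" and "r b = 0" "r' b X = 0"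
  shows "((\<lambda>t. r (b + (t *\<^sub>R X + (k * t\<^sup>2) *\<^sub>R n)) / t\<^sup>2) \<longlongrightarrow> r'' X X / 2 + k * r' b n) (at 0)"
proof -
  define v where "v t = t *\<^sub>R X + (k * t\<^sup>2) *\<^sub>R n" for t
  define w where "w t = X + (k * t) *\<^sub>R n" for t
  have vw: "v t = t *\<^sub>R w t" for t by (simp add: v_def w_def algebra_simps power2_eq_square)
  have w0: "(w \<longlongrightarrow> X) (at 0)" unfolding w_def by (auto intro!: tendsto_eq_intros)
  have v0: "(v \<longlongrightarrow> 0) (at 0)" unfolding v_def by (auto intro!: tendsto_eq_intros)
  have quad: "((\<lambda>t. k * r' b n + r'' (w t) (w t) / 2) \<longlongrightarrow> k * r' b n + r'' X X / 2) (at 0)"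
    by (intro tendsto_intros w0) auto
  have err: "((\<lambda>t. r (b + v t) / t\<^sup>2 - (k * r' b n + r'' (w t) (w t) / 2)) \<longlongrightarrow> 0) (at 0)"
  proof (rule tendstoI)
    fix e :: real assume "0 < e"
    define C where "C = (norm X + 1)\<^sup>2"
    have C: "0 < C" unfolding C_def by (rule zero_less_power) (simp add: add_nonneg_pos)
    have pos: "0 < e / (2 * C)" using \<open>0 < e\<close> C by simp
    obtain d where d: "0 < d"
      "\<And>v. norm v < d \<Longrightarrow> \<bar>r (b + v) - r b - r' b v - r'' v v / 2\<bar> \<le> (e / (2 * C)) * (norm v)\<^sup>2"
      using second_order_taylor[OF assms(1,2) dr dr' pos] by blast
    have "\<forall>\<^sub>F t in at 0. norm (v t) < d"
      using tendstoD[OF v0 d(1)] by (simp only: dist_0_norm dist_commute[of _ 0])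
    moreover have "\<forall>\<^sub>F t in at 0. norm (w t) < norm X + 1"
      using tendsto_norm[OF w0] by (rule order_tendstoD) simp
    moreover have "\<forall>\<^sub>F t in at 0. t \<noteq> (0::real)" by (simp add: eventually_at_filter)
    ultimately show "\<forall>\<^sub>F t in at 0. dist (r (b + v t) / t\<^sup>2 - (k * r' b n + r'' (w t) (w t) / 2)) 0 < e"
    proof eventually_elim
      case (elim t)
      have "r' b (v t) = t\<^sup>2 * (k * r' b n)"
        by (simp add: v_def blinfun.bilinear_simps assms)
      moreover have "r'' (v t) (v t) = t\<^sup>2 * r'' (w t) (w t)"
        by (simp add: vw blinfun.bilinear_simps power2_eq_square)
      ultimately have "r (b + v t) / t\<^sup>2 - (k * r' b n + r'' (w t) (w t) / 2)
          = (r (b + v t) - r b - r' b (v t) - r'' (v t) (v t) / 2) / t\<^sup>2"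
        using elim by (simp add: field_simps assms)
      also have "\<bar>\<dots>\<bar> \<le> (e / (2 * C)) * (norm (v t))\<^sup>2 / t\<^sup>2"
        unfolding abs_divide abs_power2 using d(2)[of "v t"] elim(1) by (intro divide_right_mono) auto
      also have "\<dots> = (e / (2 * C)) * (norm (w t))\<^sup>2"
        using elim by (simp add: vw power_mult_distrib)
      also have "\<dots> \<le> (e / (2 * C)) * C"
        unfolding C_def using elim \<open>0 < e\<close>
        by (intro mult_left_mono power_mono) auto
      also have "\<dots> < e" using C \<open>0 < e\<close> by simp
      finally show ?case by (simp add: dist_norm)
    qed
  qed
  show ?thesis
    using tendsto_add[OF err quad] by (simp add: v_def add.commute)
qed

text \<open>Gronwall: \<open>f\<close> vanishes identically or nowhere.\<close>

lemma abs_deriv_le_imp_same_sign: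
  fixes f :: "real \<Rightarrow> real"
  assumes ab: "a \<le> b" and df: "\<And>x. \<lbrakk>a \<le> x; x \<le> b\<rbrakk> \<Longrightarrow> (f has_real_derivative f' x) (at x)"
    and le: "\<And>x. \<lbrakk>a \<le> x; x \<le> b\<rbrakk> \<Longrightarrow> \<bar>f' x\<bar> \<le> C * \<bar>f x\<bar>"
  shows "f a < 0 \<longleftrightarrow> f b < 0"
proof -
  have bound: "\<bar>2 * f x * f' x\<bar> \<le> 2 * C * (f x)\<^sup>2" if "a \<le> x" "x \<le> b" for x
  proof -
    have "\<bar>2 * f x * f' x\<bar> = \<bar>2 * f x\<bar> * \<bar>f' x\<bar>" by (simp add: abs_mult)
    also have "\<dots> \<le> \<bar>2 * f x\<bar> * (C * \<bar>f x\<bar>)" by (rule mult_left_mono[OF le[OF that]]) simp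
    also have "\<dots> = 2 * C * (f x)\<^sup>2" by (cases "f x \<ge> 0") (simp_all add: power2_eq_square)
    finally show ?thesis .
  qed
  have dn: "(f y)\<^sup>2 * exp (- 2 * C * y) \<le> (f x)\<^sup>2 * exp (- 2 * C * x)"
    if "a \<le> x" "x \<le> y" "y \<le> b" for x y
  proof (rule DERIV_nonpos_imp_nonincreasing[OF that(2)])
    fix t assume t: "x \<le> t" "t \<le> y"
    then have t': "a \<le> t" "t \<le> b" using that by auto
    show "\<exists>d. ((\<lambda>x. (f x)\<^sup>2 * exp (- 2 * C * x)) has_real_derivative d) (at t) \<and> d \<le> 0"
    proof (intro exI conjI)
      show "((\<lambda>x. (f x)\<^sup>2 * exp (- 2 * C * x)) has_real_derivative
          (2 * f t * f' t - 2 * C * (f t)\<^sup>2) * exp (- 2 * C * t)) (at t)"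
        by (auto intro!: derivative_eq_intros df t' simp: algebra_simps)
      show "(2 * f t * f' t - 2 * C * (f t)\<^sup>2) * exp (- 2 * C * t) \<le> 0"
        using bound[OF t'] by (simp add: mult_le_0_iff)
    qed
  qed
  have up: "(f x)\<^sup>2 * exp (2 * C * x) \<le> (f y)\<^sup>2 * exp (2 * C * y)"
    if "a \<le> x" "x \<le> y" "y \<le> b" for x y
  proof (rule DERIV_nonneg_imp_nondecreasing[OF that(2)])
    fix t assume t: "x \<le> t" "t \<le> y"
    then have t': "a \<le> t" "t \<le> b" using that by auto
    show "\<exists>d. ((\<lambda>x. (f x)\<^sup>2 * exp (2 * C * x)) has_real_derivative d) (at t) \<and> d \<ge> 0"
    proof (intro exI conjI)
      show "((\<lambda>x. (f x)\<^sup>2 * exp (2 * C * x)) has_real_derivative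
          (2 * f t * f' t + 2 * C * (f t)\<^sup>2) * exp (2 * C * t)) (at t)"
        by (auto intro!: derivative_eq_intros df t' simp: algebra_simps)
      show "(2 * f t * f' t + 2 * C * (f t)\<^sup>2) * exp (2 * C * t) \<ge> 0"
        using bound[OF t'] by simp
    qed
  qed
  \<comment> \<open>A zero spreads to the right by \<open>dn\<close> and to the left by
    \<open>up\<close>.\<close>
  have zero: "f a = 0 \<and> f b = 0" if "f x = 0" "a \<le> x" "x \<le> b" for x
    using dn[of x b] up[of a x] that by (simp add: mult_le_0_iff)
  have cont: "continuous_on {a..b} f"
    by (intro continuous_at_imp_continuous_on ballI DERIV_isCont[OF df]) auto
  show ?thesis
  proof (cases "\<exists>x. a \<le> x \<and> x \<le> b \<and> f x = 0")
    case True
    then have "f a = 0" "f b = 0" using zero by blast+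
    then show ?thesis by simp
  next
    case False
    then show ?thesis
      using IVT'[of f a 0 b, OF _ _ ab cont] IVT2'[of f b 0 a, OF _ _ ab cont]
      by (meson linorder_le_less_linear less_imp_le)
  qed
qed

text \<open>If the inequality failed, some parabola tangent to \<open>X\<close> would have its
  curvature strictly between those of the two boundaries. It would run in \<open>{r1 < 0}\<close>
  while its image under the scaling runs in \<open>{r2 > 0}\<close>.\<close>

lemma second_order_germ_le:
  fixes r1 r2 :: "'a::real_normed_vector \<Rightarrow> real"
    and r1' r2' :: "'a \<Rightarrow> 'a \<Rightarrow>\<^sub>L real" and r1'' r2'' :: "'a \<Rightarrow>\<^sub>L 'a \<Rightarrow>\<^sub>L real"
  assumes 1: "open U1" "p \<in> U1" "\<And>x. x \<in> U1 \<Longrightarrow> (r1 has_derivative r1' x) (at x)"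
      "(r1' has_derivative r1'') (at p)" "r1 p = 0"
    and 2: "open U2" "q \<in> U2" "\<And>x. x \<in> U2 \<Longrightarrow> (r2 has_derivative r2' x) (at x)"
      "(r2' has_derivative r2'') (at q)" "r2 q = 0"
    and imp: "\<forall>\<^sub>F v in nhds 0. r1 (p + v) < 0 \<longrightarrow> r2 (q + s *\<^sub>R v) < 0"
    and r2q: "r2' q = c *\<^sub>R r1' p" "0 < c" and n: "0 < r1' p n" and "0 < s" and X: "r1' p X = 0"
  shows "s * r2'' X X \<le> c * r1'' X X"
proof (rule ccontr)
  assume "\<not> ?thesis"
  then have "c * r1'' X X / (2 * c) < s * r2'' X X / (2 * c)"
    using \<open>0 < c\<close> by (intro divide_strict_right_mono) auto
  then have "r1'' X X / 2 < s * r2'' X X / (2 * c)" using \<open>0 < c\<close> by simp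
  then obtain y where y: "r1'' X X / 2 < y" "y < s * r2'' X X / (2 * c)" using dense by blast
  \<comment> \<open>This \<open>k\<close> makes the quadratic part of the parabola contribute
    \<open>- y\<close>, so both limits below get a strict sign.\<close>
  define k where "k = - y / r1' p n"
  have kn: "k * r1' p n = - y" using n by (simp add: k_def)
  let ?v = "\<lambda>t. t *\<^sub>R X + (k * t\<^sup>2) *\<^sub>R n"
  have "((\<lambda>t. r1 (p + ?v t) / t\<^sup>2) \<longlongrightarrow> r1'' X X / 2 + k * r1' p n) (at 0)"
    by (rule parabola_expansion[OF 1(1-4) 1(5) X])
  then have l1: "\<forall>\<^sub>F t in at 0. r1 (p + ?v t) / t\<^sup>2 < 0"
    by (rule order_tendstoD) (use y kn in simp)
  have sX: "r2' q (s *\<^sub>R X) = 0" by (simp add: r2q blinfun.bilinear_simps X)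
  have "((\<lambda>t. r2 (q + (t *\<^sub>R (s *\<^sub>R X) + (k * t\<^sup>2) *\<^sub>R (s *\<^sub>R n))) / t\<^sup>2)
      \<longlongrightarrow> r2'' (s *\<^sub>R X) (s *\<^sub>R X) / 2 + k * r2' q (s *\<^sub>R n)) (at 0)"
    by (rule parabola_expansion[OF 2(1-4) 2(5) sX])
  moreover have "k * r2' q (s *\<^sub>R n) = - s * c * y"
  proof -
    have "k * r2' q (s *\<^sub>R n) = s * c * (k * r1' p n)" by (simp add: r2q blinfun.bilinear_simps)
    then show ?thesis by (simp add: kn)
  qed
  moreover have "0 < s * (s * r2'' X X) / 2 - s * c * y"
    using y(2) \<open>0 < c\<close> \<open>0 < s\<close> by (simp add: field_simps)
  ultimately have "\<forall>\<^sub>F t in at 0. 0 < r2 (q + (t *\<^sub>R (s *\<^sub>R X) + (k * t\<^sup>2) *\<^sub>R (s *\<^sub>R n))) / t\<^sup>2"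
    by (intro order_tendstoD) (auto simp: blinfun.bilinear_simps)
  moreover have "t *\<^sub>R (s *\<^sub>R X) + (k * t\<^sup>2) *\<^sub>R (s *\<^sub>R n) = s *\<^sub>R ?v t" for t
    by (simp add: algebra_simps)
  ultimately have l2: "\<forall>\<^sub>F t in at 0. 0 < r2 (q + s *\<^sub>R ?v t) / t\<^sup>2" by simp
  have "(?v \<longlongrightarrow> 0) (at 0)" by (auto intro!: tendsto_eq_intros)
  from eventually_compose_filterlim[OF imp this] l1 l2
  have "\<forall>\<^sub>F t in at (0::real). False"
  proof eventually_elim
    case (elim t)
    have "r1 (p + ?v t) < 0" using elim(2) divide_nonneg_nonneg[OF _ zero_le_power2] by (meson not_le)
    moreover have "0 < r2 (q + s *\<^sub>R ?v t)"
      using elim(3) divide_nonpos_nonneg[OF _ zero_le_power2] by (meson not_le)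
    ultimately show False using elim(1) by linarith
  qed
  then show False by simp
qed

lemma first_order_germ_le:
  fixes r1 r2 :: "'a::real_normed_vector \<Rightarrow> real"
  assumes "(r1 has_derivative r1') (at p)" "r1 p = 0" "(r2 has_derivative r2') (at q)" "r2 q = 0"
    and imp: "\<forall>\<^sub>F v in nhds 0. r1 (p + v) < 0 \<longrightarrow> r2 (q + s *\<^sub>R v) < 0"
    and "0 < s" "r1' v < 0"
  shows "r2' v \<le> 0"
proof -
  have lim: "((\<lambda>t. r (b + t *\<^sub>R v) / t) \<longlongrightarrow> r' v) (at_right 0)"
    if "(r has_derivative r') (at b)" "r b = 0" for r :: "'a \<Rightarrow> real" and r' b v
  proof -
    have "((\<lambda>t. r (b + t *\<^sub>R v)) has_derivative (\<lambda>t. r' (t *\<^sub>R v))) (at 0)"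
      using that(1) by (auto intro!: derivative_eq_intros has_derivative_compose[of "\<lambda>t. b + t *\<^sub>R v" _ 0 UNIV r])
    then have "((\<lambda>t. r (b + t *\<^sub>R v)) has_real_derivative r' v) (at 0)"
      using has_derivative_linear[OF that(1)]
      by (simp add: has_field_derivative_def linear_cmul mult.commute[of _ "r' v"])
    then have "((\<lambda>t. r (b + t *\<^sub>R v) / t) \<longlongrightarrow> r' v) (at 0)"
      by (simp add: DERIV_def that)
    then show ?thesis by (rule filterlim_mono) (auto simp: at_le)
  qed
  have "((\<lambda>t. r1 (p + t *\<^sub>R v) / t) \<longlongrightarrow> r1' v) (at_right 0)" by (rule lim) fact+
  then have l1: "\<forall>\<^sub>F t in at_right 0. r1 (p + t *\<^sub>R v) / t < 0"
    using assms(7) by (rule order_tendstoD)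
  have "((\<lambda>t. r2 (q + t *\<^sub>R (s *\<^sub>R v)) / t) \<longlongrightarrow> r2' (s *\<^sub>R v)) (at_right 0)" by (rule lim) fact+
  moreover have "\<forall>\<^sub>F t in at_right 0. r2 (q + t *\<^sub>R (s *\<^sub>R v)) / t \<le> 0"
  proof -
    have "((\<lambda>t. t *\<^sub>R v) \<longlongrightarrow> 0) (at_right (0::real))" by (auto intro!: tendsto_eq_intros)
    from eventually_compose_filterlim[OF imp this] l1 eventually_at_right_less[of "0::real"]
    show ?thesis
      by eventually_elim (auto simp: divide_less_0_iff divide_le_0_iff mult.commute)
  qed
  ultimately have "r2' (s *\<^sub>R v) \<le> 0" by (rule tendsto_upperbound) simp
  then show ?thesis
    using has_derivative_linear[OF assms(3)] \<open>0 < s\<close> by (simp add: linear_cmul mult_le_0_iff)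
qed

text \<open>The kernel of \<open>A\<close> must lie in that of \<open>B\<close>: shifting
  \<open>- n\<close> along a kernel vector of \<open>A\<close> keeps \<open>A\<close> negative, but
  would give \<open>B\<close> any prescribed value.\<close>

lemma nonpos_on_halfspace_imp_proportional:
  fixes A B :: "'a::real_normed_vector \<Rightarrow>\<^sub>L real"
  assumes "\<And>v. A v < 0 \<Longrightarrow> B v \<le> 0" and "B \<noteq> 0" and n: "0 < A n"
  obtains c where "0 < c" "B = c *\<^sub>R A"
proof -
  have B0: "B v = 0" if "A v = 0" for v
  proof (rule ccontr)
    assume v: "B v \<noteq> 0"
    \<comment> \<open>The coefficient is chosen so that \<open>B\<close> takes the value 1
      here.\<close>
    have "B (((B n + 1) / B v) *\<^sub>R v - n) \<le> 0"
      by (rule assms(1)) (simp add: blinfun.bilinear_simps that n)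
    then show False using v by (simp add: blinfun.bilinear_simps)
  qed
  define c where "c = B n / A n"
  have eq: "B w = c * A w" for w
    using B0[of "w - (A w / A n) *\<^sub>R n"] n by (simp add: blinfun.bilinear_simps c_def field_simps)
  have "0 \<le> c" using assms(1)[of "- n"] n by (simp add: c_def blinfun.bilinear_simps)
  moreover have "B = c *\<^sub>R A" by (rule blinfun_eqI) (simp add: eq blinfun.bilinear_simps)
  ultimately show thesis using \<open>B \<noteq> 0\<close> that by force
qed

lemma blinfun_nonzero_pos:
  fixes A :: "'a::real_normed_vector \<Rightarrow>\<^sub>L real"
  assumes "A \<noteq> 0"
  obtains n where "norm n = 1" "0 < A n"
proof -
  obtain n0 where "A n0 \<noteq> 0" using assms by (metis blinfun_eqI zero_blinfun.rep_eq)
  then have "\<exists>n. 0 < A n"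
    by (metis linorder_neqE_linordered_idom blinfun.minus_right neg_0_less_iff_less)
  then obtain n where n: "0 < A n" ..
  then have "n \<noteq> 0" by auto
  show thesis
    by (rule that[of "n /\<^sub>R norm n"]) (use n \<open>n \<noteq> 0\<close> in \<open>auto simp: blinfun.bilinear_simps\<close>)
qed

text \<open>The comparison is applied in both directions, the second time with scale
  \<open>1 / s\<close> and factor \<open>1 / c\<close>. Only tangent vectors can be compared:
  multiplying a defining function by a positive function changes its second derivative in the other
  directions.\<close>

lemma germ_eq_imp_second_order:
  fixes r1 r2 :: "'a::real_normed_vector \<Rightarrow> real"
    and r1' r2' :: "'a \<Rightarrow> 'a \<Rightarrow>\<^sub>L real" and r1'' r2'' :: "'a \<Rightarrow>\<^sub>L 'a \<Rightarrow>\<^sub>L real"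
  assumes 1: "open U1" "p \<in> U1" "\<And>x. x \<in> U1 \<Longrightarrow> (r1 has_derivative r1' x) (at x)"
      "(r1' has_derivative r1'') (at p)" "r1 p = 0" "r1' p \<noteq> 0"
    and 2: "open U2" "q \<in> U2" "\<And>x. x \<in> U2 \<Longrightarrow> (r2 has_derivative r2' x) (at x)"
      "(r2' has_derivative r2'') (at q)" "r2 q = 0" "r2' q \<noteq> 0"
    and eq: "\<forall>\<^sub>F v in nhds 0. r1 (p + v) < 0 \<longleftrightarrow> r2 (q + s *\<^sub>R v) < 0" and "0 < s"
  obtains c where "0 < c" "r2' q = c *\<^sub>R r1' p" "\<And>X. r1' p X = 0 \<Longrightarrow> s * r2'' X X = c * r1'' X X"
proof -
  obtain n where n: "0 < r1' p n" using blinfun_nonzero_pos[OF 1(6)] by metis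
  have imp1: "\<forall>\<^sub>F v in nhds 0. r1 (p + v) < 0 \<longrightarrow> r2 (q + s *\<^sub>R v) < 0"
    using eq by eventually_elim simp
  have "((\<lambda>v. (1 / s) *\<^sub>R v) \<longlongrightarrow> 0) (nhds (0::'a))"
    by (auto intro!: tendsto_eq_intros filterlim_ident)
  from eventually_compose_filterlim[OF eq this]
  have imp2: "\<forall>\<^sub>F v in nhds 0. r2 (q + v) < 0 \<longrightarrow> r1 (p + (1 / s) *\<^sub>R v) < 0"
    by eventually_elim (use \<open>0 < s\<close> in simp)
  obtain c where c: "0 < c" "r2' q = c *\<^sub>R r1' p"
    using nonpos_on_halfspace_imp_proportional[OF
        first_order_germ_le[OF 1(3)[OF 1(2)] 1(5) 2(3)[OF 2(2)] 2(5) imp1 \<open>0 < s\<close>] 2(6) n] .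
  have "s * r2'' X X = c * r1'' X X" if X: "r1' p X = 0" for X
  proof (rule antisym)
    show "s * r2'' X X \<le> c * r1'' X X"
      by (rule second_order_germ_le[OF 1(1-5) 2(1-5) imp1 c(2,1) n \<open>0 < s\<close> X])
    have "(1 / s) * r1'' X X \<le> (1 / c) * r2'' X X"
      by (rule second_order_germ_le[OF 2(1-5) 1(1-5) imp2, where n = n])
        (use c n X \<open>0 < s\<close> in \<open>auto simp: blinfun.bilinear_simps\<close>)
    then show "c * r1'' X X \<le> s * r2'' X X" using c \<open>0 < s\<close> by (simp add: field_simps)
  qed
  with c that show thesis by blast
qed

section \<open>Local invariance under dilations\<close>

text \<open>A defining function together with its first two derivatives as explicit maps, so that
  they can be evaluated and passed to limits. Real Euclidean spaces suffice for everything that does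
  not mention the Levi form.\<close>

definition C2_chart :: "'a::euclidean_space set \<Rightarrow> 'a set \<Rightarrow> ('a \<Rightarrow> real) \<Rightarrow>
    ('a \<Rightarrow> 'a \<Rightarrow>\<^sub>L real) \<Rightarrow> ('a \<Rightarrow> 'a \<Rightarrow>\<^sub>L 'a \<Rightarrow>\<^sub>L real) \<Rightarrow> bool"
  where "C2_chart D U r r' r'' \<longleftrightarrow> open U \<and>
    (\<forall>x\<in>U. (r has_derivative r' x) (at x)) \<and> (\<forall>x\<in>U. (r' has_derivative r'' x) (at x)) \<and>
    continuous_on U r'' \<and> D \<inter> U = {z \<in> U. r z < 0} \<and> frontier D \<inter> U = {z \<in> U. r z = 0} \<and>
    (\<forall>z\<in>frontier D \<inter> U. r' z \<noteq> 0)"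

lemma C2_chartD:
  assumes "C2_chart D U r r' r''"
  shows "open U" "\<And>x. x \<in> U \<Longrightarrow> (r has_derivative r' x) (at x)"
    "\<And>x. x \<in> U \<Longrightarrow> (r' has_derivative r'' x) (at x)" "continuous_on U r''"
    "\<And>z. z \<in> U \<Longrightarrow> z \<in> D \<longleftrightarrow> r z < 0" "\<And>z. z \<in> U \<Longrightarrow> z \<in> frontier D \<longleftrightarrow> r z = 0"
    "\<And>z. z \<in> U \<Longrightarrow> z \<in> frontier D \<Longrightarrow> r' z \<noteq> 0"
  using assms unfolding C2_chart_def by blast+

lemma C2_chart_isCont:
  assumes "C2_chart D U r r' r''" "b \<in> U"
  shows "isCont r b" "isCont r' b" "isCont r'' b"
proof -
  note c = C2_chartD[OF assms(1)]
  show "isCont r b" "isCont r' b"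
    using c(2,3)[OF assms(2)] has_derivative_continuous by blast+
  show "isCont r'' b" using c(1,4) assms(2) by (simp add: continuous_on_eq_continuous_at)
qed

text \<open>The Lipschitz function \<open>r' z (z - a)\<close> vanishes on \<open>{r = 0}\<close>, and \<open>z\<close> has distance \<open>O(|r z|)\<close>
  from this set.\<close>

lemma tangential_radial_derivative_bound:
  fixes D :: "'a::euclidean_space set"
  assumes chart: "C2_chart D U r r' r''" and m: "m \<in> frontier D" "m \<in> U" and "0 < e"
    and rad: "\<And>z. z \<in> frontier D \<Longrightarrow> dist z m < e \<Longrightarrow> r' z (z - a) = 0"
  shows "\<exists>d>0. \<exists>C. \<forall>z. dist z m < d \<longrightarrow> z \<in> U \<and> \<bar>r' z (z - a)\<bar> \<le> C * \<bar>r z\<bar>"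
proof -
  note c = C2_chartD[OF chart] and cont = C2_chart_isCont[OF chart m(2)]
  obtain n where n: "norm n = 1" "0 < r' m n" using blinfun_nonzero_pos[OF c(7)[OF m(2,1)]] .
  \<comment> \<open>Half the transversal derivative at \<open>m\<close> remains a lower bound for it
    near \<open>m\<close>.\<close>
  define k where "k = r' m n / 2"
  have k: "0 < k" "k < r' m n" using n by (auto simp: k_def)
  define g where "g z = r' z (z - a)" for z
  define g' where "g' z = (\<lambda>v. r'' z v (z - a) + r' z v)" for z
  define L where "L = norm (r'' m) * norm (m - a) + norm (r' m) + 1"
  have "\<forall>\<^sub>F z in nhds m. k < r' z n"
    using cont(2) k by (intro order_tendstoD) (auto intro!: tendsto_intros simp: isCont_def tendsto_at_iff_tendsto_nhds)
  moreover have "\<forall>\<^sub>F z in nhds m. z \<in> U" using c(1) m(2) by (rule eventually_nhds_in_open)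
  moreover have "\<forall>\<^sub>F z in nhds m. dist z m < e" using \<open>0 < e\<close> by (auto simp: eventually_nhds_metric)
  moreover have "\<forall>\<^sub>F z in nhds m. norm (r'' z) * norm (z - a) + norm (r' z) < L"
  proof (rule order_tendstoD)
    show "((\<lambda>z. norm (r'' z) * norm (z - a) + norm (r' z)) \<longlongrightarrow> norm (r'' m) * norm (m - a) + norm (r' m)) (nhds m)"
      using cont unfolding isCont_def tendsto_at_iff_tendsto_nhds
      by (intro tendsto_intros filterlim_ident)
  qed (simp add: L_def)
  ultimately have "\<forall>\<^sub>F z in nhds m. k < r' z n \<and> z \<in> U \<and> dist z m < e \<and>
      norm (r'' z) * norm (z - a) + norm (r' z) < L"
    by eventually_elim simp
  then obtain d where d: "0 < d" and near: "\<And>z. dist z m < d \<Longrightarrow> k < r' z n \<and> z \<in> U \<and> dist z m < e \<and>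
      norm (r'' z) * norm (z - a) + norm (r' z) < L"
    unfolding eventually_nhds_metric by blast
  have lip: "\<bar>g y - g z\<bar> \<le> L * norm (y - z)" if "dist y m < d" "dist z m < d" for y z
  proof -
    have "norm (g y - g z) \<le> L * norm (y - z)"
    proof (rule differentiable_bound[of "ball m d"])
      fix x assume "x \<in> ball m d"
      then have x: "dist x m < d" by (simp add: dist_commute)
      then have xU: "x \<in> U" using near by blast
      show "(g has_derivative g' x) (at x within ball m d)"
        unfolding g_def g'_def
        by (rule has_derivative_at_withinI)
          (auto intro!: derivative_eq_intros c(3)[OF xU] simp: blinfun.bilinear_simps algebra_simps)
      show "onorm (g' x) \<le> L"
      proof (rule onorm_le)
        fix v
        have "norm (g' x v) \<le> norm (r'' x v (x - a)) + norm (r' x v)"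
          unfolding g'_def by (rule norm_triangle_ineq)
        also have "\<dots> \<le> norm (r'' x v) * norm (x - a) + norm (r' x) * norm v"
          by (intro add_mono norm_blinfun)
        also have "\<dots> \<le> (norm (r'' x) * norm v) * norm (x - a) + norm (r' x) * norm v"
          by (intro add_mono mult_right_mono norm_blinfun) auto
        also have "\<dots> = (norm (r'' x) * norm (x - a) + norm (r' x)) * norm v" by (simp add: algebra_simps)
        also have "\<dots> \<le> L * norm v" using near[OF x] by (intro mult_right_mono) auto
        finally show "norm (g' x v) \<le> L * norm v" .
      qed
    qed (use that in \<open>auto simp: dist_commute\<close>)
    then show ?thesis by simp
  qed
  have "\<forall>\<^sub>F z in nhds m. \<bar>r z\<bar> < k * d / 4"
  proof -
    have "((\<lambda>z. \<bar>r z\<bar>) \<longlongrightarrow> \<bar>r m\<bar>) (nhds m)"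
      using cont(1) by (auto intro!: tendsto_intros simp: isCont_def tendsto_at_iff_tendsto_nhds)
    moreover have "\<bar>r m\<bar> < k * d / 4" using c(6)[OF m(2)] m(1) k d by simp
    ultimately show ?thesis by (rule order_tendstoD)
  qed
  then obtain d' where d': "0 < d'" and small: "\<And>z. dist z m < d' \<Longrightarrow> \<bar>r z\<bar> < k * d / 4"
    unfolding eventually_nhds_metric by blast
  have "\<bar>r' z (z - a)\<bar> \<le> (L / k) * \<bar>r z\<bar>" if z: "dist z m < min d' (d / 2)" for z
  proof -
    \<comment> \<open>As \<open>r\<close> grows at rate at least \<open>k\<close> in direction
      \<open>n\<close>, it has a zero on this line within distance \<open>s\<close> of
      \<open>z\<close>. The bound \<open>k * d / 4\<close> on \<open>r\<close> keeps
      \<open>s\<close> below \<open>d / 4\<close>, so the zero stays in the ball.\<close>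
    define s where "s = \<bar>r z\<bar> / k"
    have s: "0 \<le> s" "s < d / 4" using small[of z] z k by (auto simp: s_def field_simps)
    have inball: "dist (z + t *\<^sub>R n) m < d" if "\<bar>t\<bar> \<le> s" for t
    proof -
      have "dist (z + t *\<^sub>R n) m \<le> dist z m + \<bar>t\<bar>"
        using norm_triangle_ineq[of "z - m" "t *\<^sub>R n"] by (simp add: dist_norm n algebra_simps)
      then show ?thesis using that s z by simp
    qed
    define f where "f t = r (z + t *\<^sub>R n)" for t
    have df: "(f has_real_derivative r' (z + t *\<^sub>R n) n) (at t)" if "\<bar>t\<bar> \<le> s" for t
    proof -
      have "(f has_derivative (\<lambda>h. r' (z + t *\<^sub>R n) (h *\<^sub>R n))) (at t)"
        unfolding f_def
        by (rule has_derivative_compose[where f = "\<lambda>t. z + t *\<^sub>R n"])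
          (use inball[OF that] near c(2) in \<open>auto intro!: derivative_eq_intros\<close>)
      then show ?thesis
        by (simp add: has_field_derivative_def blinfun.bilinear_simps mult.commute[of _ "r' (z + t *\<^sub>R n) n"])
    qed
    have mono: "f x - k * x \<le> f y - k * y" if "- s \<le> x" "x \<le> y" "y \<le> s" for x y
    proof (rule DERIV_nonneg_imp_nondecreasing[OF that(2)])
      fix t assume "x \<le> t" "t \<le> y"
      then have t: "\<bar>t\<bar> \<le> s" using that by auto
      have "((\<lambda>t. f t - k * t) has_real_derivative r' (z + t *\<^sub>R n) n - k) (at t)"
        by (auto intro!: derivative_eq_intros df[OF t])
      then show "\<exists>y. ((\<lambda>t. f t - k * t) has_real_derivative y) (at t) \<and> 0 \<le> y"
        using near[OF inball[OF t]] by force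
    qed
    have cont: "continuous_on {- s..s} f"
      by (intro continuous_at_imp_continuous_on ballI DERIV_isCont[OF df]) auto
    have "f (- s) \<le> 0" "0 \<le> f s"
      using mono[of "- s" 0] mono[of 0 s] s k by (auto simp: f_def s_def)
    then obtain t where t: "- s \<le> t" "t \<le> s" "f t = 0"
      using IVT'[of f "- s" 0 s, OF _ _ _ cont] s by auto
    then have ts: "\<bar>t\<bar> \<le> s" by simp
    have "g (z + t *\<^sub>R n) = 0"
      unfolding g_def using near[OF inball[OF ts]] t(3) c(6) by (intro rad) (auto simp: f_def)
    then have "\<bar>g z\<bar> \<le> L * \<bar>t\<bar>"
      using lip[of "z + t *\<^sub>R n" z] inball[OF ts] z d by (auto simp: n)
    also have "\<dots> \<le> L * s" using ts by (intro mult_left_mono) (auto simp: L_def)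
    finally show ?thesis by (simp add: g_def s_def)
  qed
  moreover have "z \<in> U" if "dist z m < min d' (d / 2)" for z using near[of z] that d by simp
  ultimately show ?thesis using d d' by (intro exI[of _ "min d' (d / 2)"]) (auto intro!: exI[of _ "L / k"])
qed

text \<open>Along a ray from \<open>a\<close> the derivative of \<open>r\<close> is bounded by a
  multiple of \<open>r\<close> itself, so the sign of \<open>r\<close> cannot change there.\<close>

lemma local_dilation_invariance:
  fixes D :: "'a::euclidean_space set"
  assumes chart: "C2_chart D U r r' r''" and m: "m \<in> frontier D" "m \<in> U" and "0 < e"
    and rad: "\<And>z. z \<in> frontier D \<Longrightarrow> dist z m < e \<Longrightarrow> r' z (z - a) = 0"
  shows "\<exists>d>0. \<forall>z t. dist z m < d \<longrightarrow> \<bar>t - 1\<bar> < d \<longrightarrow> (a + t *\<^sub>R (z - a) \<in> D \<longleftrightarrow> z \<in> D)"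
proof -
  note c = C2_chartD[OF chart]
  obtain d C where d: "0 < d" and bd: "\<And>z. dist z m < d \<Longrightarrow> z \<in> U \<and> \<bar>r' z (z - a)\<bar> \<le> C * \<bar>r z\<bar>"
    using tangential_radial_derivative_bound[OF assms] by blast
  define R where "R = norm (m - a) + 1"
  have R: "1 \<le> R" by (simp add: R_def)
  \<comment> \<open>The bound \<open>1 / 2\<close> keeps \<open>t\<close> at least
    \<open>1 / 2\<close>: the radial vector at \<open>?p\<close> is \<open>t\<close> times
    \<open>z - a\<close>, and dividing by \<open>t\<close> turns \<open>C\<close> into
    \<open>2 * C\<close>. The bound with \<open>R\<close> controls the displacement by
    \<open>(t - 1)\<close> times \<open>z - a\<close>.\<close>
  define d1 where "d1 = min (1 / 2) (min (d / 2) (d / (2 * R)))"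
  have d1: "0 < d1" "d1 \<le> 1 / 2" "d1 \<le> d / 2" "d1 \<le> d / (2 * R)" using d R by (auto simp: d1_def)
  have inball: "dist (a + t *\<^sub>R (z - a)) m < d" if "dist z m < d1" "\<bar>t - 1\<bar> < d1" for z t
  proof -
    have "norm (z - a) \<le> norm (z - m) + norm (m - a)"
      using norm_triangle_ineq[of "z - m" "m - a"] by simp
    then have zR: "norm (z - a) \<le> R" using that d1 by (simp add: R_def dist_norm)
    have eq: "a + t *\<^sub>R (z - a) - m = (z - m) + (t - 1) *\<^sub>R (z - a)" by (simp add: algebra_simps)
    have "dist (a + t *\<^sub>R (z - a)) m \<le> dist z m + \<bar>t - 1\<bar> * norm (z - a)"
      unfolding dist_norm eq by (rule norm_triangle_le) simp
    also have "\<dots> < d / 2 + d1 * R"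
      using that d1 zR R by (intro add_less_le_mono mult_mono) auto
    also have "d1 * R \<le> d / 2" using mult_right_mono[OF d1(4), of R] R by (simp add: field_simps)
    finally show ?thesis by simp
  qed
  have main: "r (a + x *\<^sub>R (z - a)) < 0 \<longleftrightarrow> r (a + y *\<^sub>R (z - a)) < 0"
    if "x \<le> y" "\<bar>x - 1\<bar> < d1" "\<bar>y - 1\<bar> < d1" "dist z m < d1" for x y z
  proof (rule abs_deriv_le_imp_same_sign[OF that(1)])
    fix t assume "x \<le> t" "t \<le> y"
    then have t: "\<bar>t - 1\<bar> < d1" using that by auto
    then have tpos: "1 / 2 \<le> t" using d1 by auto
    let ?p = "a + t *\<^sub>R (z - a)"
    have p: "?p \<in> U" "\<bar>r' ?p (?p - a)\<bar> \<le> C * \<bar>r ?p\<bar>" using bd[OF inball[OF that(4) t]] by auto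
    have "((\<lambda>t. r (a + t *\<^sub>R (z - a))) has_derivative (\<lambda>h. r' ?p (h *\<^sub>R (z - a)))) (at t)"
      by (rule has_derivative_compose[where f = "\<lambda>t. a + t *\<^sub>R (z - a)", OF _ c(2)[OF p(1)]])
        (auto intro!: derivative_eq_intros)
    then show "((\<lambda>t. r (a + t *\<^sub>R (z - a))) has_real_derivative r' ?p (z - a)) (at t)"
      by (simp add: has_field_derivative_def blinfun.scaleR_right mult.commute[of _ "r' ?p (z - a)"])
    have "t * \<bar>r' ?p (z - a)\<bar> \<le> C * \<bar>r ?p\<bar>"
      using p(2) tpos by (simp add: blinfun.scaleR_right abs_mult)
    moreover have "1 / 2 * \<bar>r' ?p (z - a)\<bar> \<le> t * \<bar>r' ?p (z - a)\<bar>"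
      using tpos by (intro mult_right_mono) auto
    ultimately show "\<bar>r' ?p (z - a)\<bar> \<le> (2 * C) * \<bar>r ?p\<bar>" by linarith
  qed
  show ?thesis
  proof (intro exI conjI allI impI)
    show "0 < d1" by (fact d1)
    fix z t assume z: "dist z m < d1" and t: "\<bar>t - 1\<bar> < d1"
    have "r (a + t *\<^sub>R (z - a)) < 0 \<longleftrightarrow> r (a + 1 *\<^sub>R (z - a)) < 0"
      using main[of t 1 z] main[of 1 t z] z t d1 by (cases "t \<le> 1") auto
    moreover have "a + t *\<^sub>R (z - a) \<in> U" "z \<in> U"
      using bd[OF inball[OF z t]] bd[of z] z d1 d by auto
    ultimately show "a + t *\<^sub>R (z - a) \<in> D \<longleftrightarrow> z \<in> D" by (simp add: c(5))
  qed
qed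

section \<open>The Levi form\<close>

lemma vector_smult_complex: "z *s X = Re z *\<^sub>R X + Im z *\<^sub>R (\<i> *s X)" for X :: "complex ^ 'n"
  by (simp add: vec_eq_iff complex_eq_iff)

lemma bounded_linear_smult_left: "bounded_linear (\<lambda>z. z *s X)" for X :: "complex ^ 'n"
  by (intro linear_conv_bounded_linear[THEN iffD1] linearI) (simp_all add: vec_eq_iff algebra_simps)

lemma bounded_linear_smult_right: "bounded_linear ((*s) z)" for z :: complex
  by (intro linear_conv_bounded_linear[THEN iffD1] linearI) (simp_all add: vec_eq_iff algebra_simps)

lemma real_linear_complex_expand:
  fixes A :: "complex ^ 'n \<Rightarrow> 'b::real_vector"
  assumes "linear A"
  shows "A X = (\<Sum>j\<in>UNIV. Re (X $ j) *\<^sub>R A (axis j 1) + Im (X $ j) *\<^sub>R A (axis j \<i>))"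
proof -
  have "X = (\<Sum>j\<in>UNIV. Re (X $ j) *\<^sub>R axis j 1 + Im (X $ j) *\<^sub>R axis j \<i>)"
    by (auto simp: vec_eq_iff axis_def complex_eq_iff if_distrib sum.distrib cong: if_cong)
  then have "A X = A (\<Sum>j\<in>UNIV. Re (X $ j) *\<^sub>R axis j 1 + Im (X $ j) *\<^sub>R axis j \<i>)" by simp
  then show ?thesis
    by (simp add: linear_sum[OF assms] linear_add[OF assms] linear_cmul[OF assms])
qed

text \<open>The complex linear functional with real part \<open>A\<close>. For the derivative of
  \<open>r\<close> it is twice the sum of \<open>wirtinger j r * X $ j\<close>, so its kernel is the
  complex tangent space.\<close>

definition complexify :: "((complex ^ 'n) \<Rightarrow>\<^sub>L real) \<Rightarrow> complex ^ 'n \<Rightarrow> complex"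
  where "complexify A X = Complex (A X) (- A (\<i> *s X))"

lemma Re_complexify [simp]: "Re (complexify A X) = A X"
  and Im_complexify [simp]: "Im (complexify A X) = - A (\<i> *s X)"
  by (simp_all add: complexify_def)

lemma complexify_add: "complexify A (X + Y) = complexify A X + complexify A Y"
  by (simp add: complex_eq_iff blinfun.bilinear_simps vector_add_ldistrib)

lemma complexify_smult: "complexify A (z *s X) = z * complexify A X"
proof -
  have "\<i> *s (z *s X) = Re z *\<^sub>R (\<i> *s X) - Im z *\<^sub>R X"
    by (simp add: vec_eq_iff complex_eq_iff)
  then show ?thesis
    by (simp add: complex_eq_iff vector_smult_complex[of z X] blinfun.bilinear_simps)
qed

text \<open>The real form of the Levi condition: \<open>X\<close> and \<open>\<i> *s X\<close> are
  both tangent, and the last sum is four times the real part of the Levi form when \<open>A\<close>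
  and \<open>B\<close> are the first two derivatives of \<open>r\<close>.\<close>

definition levi_negative ::
    "((complex ^ 'n) \<Rightarrow>\<^sub>L real) \<Rightarrow> ((complex ^ 'n) \<Rightarrow>\<^sub>L (complex ^ 'n) \<Rightarrow>\<^sub>L real) \<Rightarrow> complex ^ 'n \<Rightarrow> bool"
  where "levi_negative A B X \<longleftrightarrow>
    A X = 0 \<and> A (\<i> *s X) = 0 \<and> B X X + B (\<i> *s X) (\<i> *s X) < 0"

lemma C2_defining_function_imp_chart:
  assumes "C2_defining_function D b U r"
  obtains r' r'' where "C2_chart D U r r' r''"
proof -
  from assms have C2: "C2_on r U" and U: "open U" and df: "defining_function D U r"
    by (simp_all add: C2_defining_function_def)
  from C2 obtain r' where d1: "\<forall>x\<in>U. (r has_derivative blinfun_apply (r' x)) (at x)" "C1_on r' U"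
    unfolding C2_on_def by (elim exE conjE)
  from d1(2) obtain r'' where d2: "\<forall>x\<in>U. (r' has_derivative blinfun_apply (r'' x)) (at x)" "continuous_on U r''"
    unfolding C1_on_def by (elim exE conjE)
  have "r' z \<noteq> 0" if "z \<in> frontier D \<inter> U" for z
  proof -
    have "\<exists>g. GDERIV r z :> g \<and> g \<noteq> 0" using df that by (simp add: defining_function_def)
    then obtain g where g: "GDERIV r z :> g" "g \<noteq> 0" by (elim exE conjE)
    have "(r has_derivative blinfun_apply (r' z)) (at z)" using d1(1) that by simp
    from has_derivative_unique[OF this g(1)[unfolded gderiv_def]]
    have "blinfun_apply (r' z) = (\<lambda>h. h \<bullet> g)" .
    then have "r' z g = g \<bullet> g" by simp
    with g(2) show ?thesis by auto
  qed
  with d1 d2 U df have "C2_chart D U r r' r''"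
    unfolding C2_chart_def defining_function_def by simp
  then show thesis by (rule that)
qed

lemma frechet_derivative_of_real_comp:
  fixes r :: "'a::real_normed_vector \<Rightarrow> real"
  assumes "(r has_derivative r') (at z)"
  shows "frechet_derivative (\<lambda>z. complex_of_real (r z)) (at z) = (\<lambda>v. complex_of_real (r' v))"
  using has_derivative_of_real[OF assms] by (metis frechet_derivative_at)

lemma complex_tangent_iff:
  assumes "(r has_derivative blinfun_apply A) (at b)"
  shows "complex_tangent r b X \<longleftrightarrow> A X = 0 \<and> A (\<i> *s X) = 0"
proof -
  have "(\<Sum>j\<in>UNIV. wirtinger j (\<lambda>z. complex_of_real (r z)) b * X $ j)
      = (\<Sum>j\<in>UNIV. (complex_of_real (A (axis j 1)) - \<i> * complex_of_real (A (axis j \<i>))) / 2 * X $ j)"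
    by (simp add: wirtinger_def frechet_derivative_of_real_comp[OF assms])
  also have "\<dots> = complexify A X / 2"
    using real_linear_complex_expand[OF bounded_linear.linear[OF blinfun.bounded_linear_right], of A X]
      real_linear_complex_expand[OF bounded_linear.linear[OF blinfun.bounded_linear_right], of A "\<i> *s X"]
    by (auto simp: complex_eq_iff sum_divide_distrib sum_negf[symmetric] algebra_simps intro!: sum.cong)
  finally show ?thesis by (auto simp: complex_tangent_def complex_eq_iff)
qed

lemma Re_levi_form:
  assumes "open U" "b \<in> U" and dr: "\<And>x. x \<in> U \<Longrightarrow> (r has_derivative blinfun_apply (r' x)) (at x)"
    and dr': "(r' has_derivative blinfun_apply B) (at b)"
  shows "Re (levi_form r b X) = (B X X + B (\<i> *s X) (\<i> *s X)) / 4"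
proof -
  let ?e = "\<lambda>j. axis j (1::complex)" and ?f = "\<lambda>j. axis j \<i>"
  have W: "wirtinger j (wirtinger_bar k (\<lambda>z. complex_of_real (r z))) b =
      Complex (B (?e j) (?e k) + B (?f j) (?f k)) (B (?e j) (?f k) - B (?f j) (?e k)) / 4" for j k
  proof -
    let ?w = "\<lambda>z. (complex_of_real (r' z (?e k)) + \<i> * complex_of_real (r' z (?f k))) / 2"
    have w: "(?w has_derivative (\<lambda>v. (complex_of_real (B v (?e k)) + \<i> * complex_of_real (B v (?f k))) / 2)) (at b)"
      by (auto intro!: derivative_eq_intros dr' simp: blinfun.bilinear_simps)
    have eq: "?w x = wirtinger_bar k (\<lambda>z. complex_of_real (r z)) x" if "x \<in> U" for x
      by (simp add: wirtinger_bar_def frechet_derivative_of_real_comp[OF dr[OF that]])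
    have "(wirtinger_bar k (\<lambda>z. complex_of_real (r z)) has_derivative
        (\<lambda>v. (complex_of_real (B v (?e k)) + \<i> * complex_of_real (B v (?f k))) / 2)) (at b)"
      by (rule has_derivative_transform_within_open[OF w assms(1,2) eq])
    note fd = frechet_derivative_at[OF this, symmetric]
    show ?thesis unfolding wirtinger_def fd by (intro complex_eqI) (simp_all add: field_simps)
  qed
  have expand: "B Y Y = (\<Sum>j\<in>UNIV. \<Sum>k\<in>UNIV.
      Re (Y $ j) * Re (Y $ k) * B (?e j) (?e k) + Re (Y $ j) * Im (Y $ k) * B (?e j) (?f k) +
      Im (Y $ j) * Re (Y $ k) * B (?f j) (?e k) + Im (Y $ j) * Im (Y $ k) * B (?f j) (?f k))" for Y
  proof -
    have col: "B Y Z = (\<Sum>j\<in>UNIV. Re (Y $ j) * B (?e j) Z + Im (Y $ j) * B (?f j) Z)" for Z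
    proof -
      have "linear (\<lambda>V. B V Z)" by (rule linearI) (simp_all add: blinfun.bilinear_simps)
      from real_linear_complex_expand[OF this, of Y] show ?thesis by simp
    qed
    have row: "B V Y = (\<Sum>k\<in>UNIV. Re (Y $ k) * B V (?e k) + Im (Y $ k) * B V (?f k))" for V
      using real_linear_complex_expand[OF bounded_linear.linear[OF blinfun.bounded_linear_right], of "B V" Y]
      by simp
    show ?thesis
      by (simp only: col[of Y] row[of "?e j" for j] row[of "?f j" for j])
        (simp add: sum_distrib_left sum.distrib algebra_simps)
  qed
  have "Re (levi_form r b X) = (\<Sum>j\<in>UNIV. \<Sum>k\<in>UNIV.
      ((B (?e j) (?e k) + B (?f j) (?f k)) * (Re (X $ j) * Re (X $ k) + Im (X $ j) * Im (X $ k)) -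
       (B (?e j) (?f k) - B (?f j) (?e k)) * (Im (X $ j) * Re (X $ k) - Re (X $ j) * Im (X $ k))) / 4)"
    unfolding levi_form_def W Re_sum by (intro sum.cong refl) (simp add: field_simps)
  also have "\<dots> = (B X X + B (\<i> *s X) (\<i> *s X)) / 4"
    unfolding expand sum.distrib[symmetric] sum_divide_distrib
    by (intro sum.cong refl) (simp add: algebra_simps)
  finally show ?thesis .
qed

lemma non_pseudoconvex_imp_levi_negative:
  assumes "non_pseudoconvex_boundary_point D b"
  obtains U r r' r'' X where "C2_chart D U r r' r''" "b \<in> frontier D" "b \<in> U"
    "levi_negative (r' b) (r'' b) X"
proof -
  obtain U r X where *: "b \<in> frontier D" "C2_defining_function D b U r" "complex_tangent r b X"
    "Re (levi_form r b X) < 0"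
    using assms unfolding non_pseudoconvex_boundary_point_def by blast
  obtain r' r'' where chart: "C2_chart D U r r' r''"
    using C2_defining_function_imp_chart[OF *(2)] .
  note c = C2_chartD[OF chart]
  have b: "b \<in> U" using *(2) by (simp add: C2_defining_function_def)
  have "levi_negative (r' b) (r'' b) X"
    using *(3,4) complex_tangent_iff[OF c(2)[OF b], of X] Re_levi_form[OF c(1) b c(2) c(3)[OF b], of X]
    by (simp add: levi_negative_def)
  then show thesis by (rule that[OF chart *(1) b])
qed

text \<open>At a nearby \<open>z\<close> the vector \<open>X\<close> need not be complex tangent.
  Subtracting the multiple \<open>q z\<close> of a transversal vector makes it so, and as
  \<open>q z\<close> tends to 0 at \<open>b\<close>, the Levi sum stays negative.\<close>

lemma levi_negative_nearby:
  assumes chart: "C2_chart D U r r' r''" and b: "b \<in> frontier D" "b \<in> U"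
    and neg: "levi_negative (r' b) (r'' b) X"
  shows "\<exists>e>0. \<forall>z. dist z b < e \<longrightarrow> z \<in> U \<and> (\<exists>Y. levi_negative (r' z) (r'' z) Y)"
proof -
  note c = C2_chartD[OF chart] and cont = C2_chart_isCont[OF chart b(2)]
  have t: "(r' \<longlongrightarrow> r' b) (nhds b)" "(r'' \<longlongrightarrow> r'' b) (nhds b)"
    using cont by (auto simp: isCont_def tendsto_at_iff_tendsto_nhds)
  obtain n where n: "0 < r' b n" using blinfun_nonzero_pos[OF c(7)[OF b(2,1)]] by metis
  define q where "q z = complexify (r' z) X / complexify (r' z) n" for z
  define Y where "Y z = X - q z *s n" for z
  have cf: "((\<lambda>z. complexify (r' z) V) \<longlongrightarrow> complexify (r' b) V) (nhds b)" for V
    unfolding complexify_def by (intro tendsto_intros t)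
  have nz: "complexify (r' b) n \<noteq> 0" using n by (auto simp: complex_eq_iff)
  have X0: "complexify (r' b) X = 0" using neg by (simp add: levi_negative_def complex_eq_iff)
  have q0: "(q \<longlongrightarrow> 0) (nhds b)"
    using tendsto_divide[OF cf cf nz, of X] by (simp add: q_def[abs_def] X0)
  have "(Y \<longlongrightarrow> X - 0 *s n) (nhds b)"
    unfolding Y_def[abs_def]
    by (intro tendsto_intros bounded_linear.tendsto[OF bounded_linear_smult_left] q0)
  then have Yt: "(Y \<longlongrightarrow> X) (nhds b)" by simp
  have iYt: "((\<lambda>z. \<i> *s Y z) \<longlongrightarrow> \<i> *s X) (nhds b)"
    by (rule bounded_linear.tendsto[OF bounded_linear_smult_right Yt])
  have "((\<lambda>z. r'' z (Y z) (Y z) + r'' z (\<i> *s Y z) (\<i> *s Y z)) \<longlongrightarrow>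
      r'' b X X + r'' b (\<i> *s X) (\<i> *s X)) (nhds b)"
    by (intro tendsto_intros t Yt iYt)
  then have "\<forall>\<^sub>F z in nhds b. r'' z (Y z) (Y z) + r'' z (\<i> *s Y z) (\<i> *s Y z) < 0"
    by (rule order_tendstoD) (use neg in \<open>simp add: levi_negative_def\<close>)
  moreover have "\<forall>\<^sub>F z in nhds b. complexify (r' z) n \<noteq> 0"
    using tendsto_imp_eventually_ne[OF cf nz] .
  moreover have "\<forall>\<^sub>F z in nhds b. z \<in> U" using c(1) b(2) by (rule eventually_nhds_in_open)
  ultimately have "\<forall>\<^sub>F z in nhds b. z \<in> U \<and> (\<exists>Y. levi_negative (r' z) (r'' z) Y)"
  proof eventually_elim
    case (elim z)
    have "complexify (r' z) (Y z) = complexify (r' z) (X + (- q z) *s n)" by (simp add: Y_def)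
    also have "\<dots> = 0" using elim by (simp only: complexify_add complexify_smult) (simp add: q_def)
    finally have "levi_negative (r' z) (r'' z) (Y z)"
      using elim by (simp add: levi_negative_def complex_eq_iff)
    with elim show ?case by blast
  qed
  then show ?thesis unfolding eventually_nhds_metric by blast
qed

section \<open>Planes transversal to the boundary\<close>

lemma has_integral_Re_cis_multiple:
  assumes "k \<noteq> (0::nat)"
  shows "((\<lambda>\<theta>. Re (c * cis (real k * \<theta>))) has_integral 0) {0..2 * pi}"
proof -
  let ?F = "\<lambda>\<theta>. (Re c * sin (real k * \<theta>) + Im c * cos (real k * \<theta>)) / real k"
  have "((\<lambda>\<theta>. Re (c * cis (real k * \<theta>))) has_integral (?F (2 * pi) - ?F 0)) {0..2 * pi}"
  proof (rule fundamental_theorem_of_calculus)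
    fix x
    have "(?F has_real_derivative Re (c * cis (real k * x))) (at x)"
      using assms by (auto intro!: derivative_eq_intros simp: field_simps)
    then show "(?F has_vector_derivative Re (c * cis (real k * x))) (at x within {0..2 * pi})"
      by (simp add: has_real_derivative_iff_has_vector_derivative has_vector_derivative_at_within)
  qed simp
  moreover have "sin (real k * (2 * pi)) = 0" "cos (real k * (2 * pi)) = 1"
    using sin_int_2pin[of "int k"] cos_int_2pin[of "int k"] by (simp_all add: mult.commute mult.left_commute)
  ultimately show ?thesis by simp
qed

lemma cmod_add_square: "(cmod (x + y))\<^sup>2 = (cmod x)\<^sup>2 + (cmod y)\<^sup>2 + Re (2 * cnj x * y)"
  by (simp only: cmod_power2) (simp add: power2_eq_square algebra_simps)

text \<open>The function \<open>u - K |h|\<^sup>2 + |z|\<^sup>2\<close> has no local maximum: along the affine disc in the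
  direction tangent to the parabola \<open>h = const\<close>, the mean of \<open>|h|\<^sup>2\<close> changes only to fourth order
  in the radius, that of \<open>|z|\<^sup>2\<close> to second order. For large \<open>K\<close> its maximum is therefore attained
  where \<open>|z| = \<rho>\<close>.\<close>

lemma plurisubharmonic_parabolic_disc:
  fixes b X Y :: "complex ^ 'n" and q \<epsilon> :: complex
  defines "G \<equiv> \<lambda>z h. b + z *s X + (h - \<epsilon> - q * z\<^sup>2) *s Y"
  assumes u: "continuous_plurisubharmonic_on \<Omega> u" and "0 < \<rho>" "0 < \<eta>"
    and sub: "\<And>z h. cmod z \<le> \<rho> \<Longrightarrow> cmod h \<le> \<eta> \<Longrightarrow> G z h \<in> \<Omega>"
  shows "\<exists>z h. cmod z = \<rho> \<and> cmod h \<le> \<eta> \<and> u (G 0 0) \<le> u (G z h) + \<rho>\<^sup>2"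
proof -
  define N where "N = cball (0::complex) \<rho> \<times> cball (0::complex) \<eta>"
  have N: "compact N" "(0, 0) \<in> N" using assms by (auto simp: N_def compact_Times)
  have cont_u: "continuous_on \<Omega> u" using u by (simp add: continuous_plurisubharmonic_on_def)
  have cont_smult: "continuous_on S (\<lambda>x. f x *s V)" if "continuous_on S f"
    for S :: "'x::topological_space set" and f and V :: "complex ^ 'n"
    using that by (rule bounded_linear.continuous_on[OF bounded_linear_smult_left])
  have G_in: "G (fst p) (snd p) \<in> \<Omega>" if "p \<in> N" for p
    using that sub by (cases p) (auto simp: N_def)
  have cont_v: "continuous_on N (\<lambda>p. u (G (fst p) (snd p)))"
  proof (rule continuous_on_compose2[OF cont_u])
    show "continuous_on N (\<lambda>p. G (fst p) (snd p))"
      unfolding G_def by (intro continuous_intros cont_smult)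
    show "(\<lambda>p. G (fst p) (snd p)) ` N \<subseteq> \<Omega>" using G_in by blast
  qed
  obtain m where m: "\<And>p. p \<in> N \<Longrightarrow> u (G (fst p) (snd p)) \<le> m"
    using continuous_attains_sup[OF N(1) _ cont_v] N(2) by blast
  \<comment> \<open>With this \<open>K\<close> the penalised function on
    \<open>cmod h = \<eta>\<close> lies below its value at the centre, which keeps the maximum away
    from that part of the boundary.\<close>
  define K where "K = (m - u (G 0 0) + \<rho>\<^sup>2) / \<eta>\<^sup>2 + 1"
  have m0: "u (G 0 0) \<le> m" using m[OF N(2)] by simp
  have "K * \<eta>\<^sup>2 = m - u (G 0 0) + \<rho>\<^sup>2 + \<eta>\<^sup>2" using \<open>0 < \<eta>\<close> by (simp add: K_def field_simps)
  then have K\<eta>: "m - K * \<eta>\<^sup>2 + \<rho>\<^sup>2 < u (G 0 0)" using \<open>0 < \<eta>\<close> by simp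
  have K: "0 \<le> K" using m0 by (simp add: K_def)
  define \<psi> where "\<psi> p = u (G (fst p) (snd p)) - K * (cmod (snd p))\<^sup>2 + (cmod (fst p))\<^sup>2" for p
  have "continuous_on N \<psi>" unfolding \<psi>_def[abs_def] by (intro continuous_intros cont_v)
  from continuous_attains_sup[OF N(1) _ this] N(2)
  obtain p where p: "p \<in> N" "\<And>p'. p' \<in> N \<Longrightarrow> \<psi> p' \<le> \<psi> p" by blast
  obtain z h where zh: "p = (z, h)" by (cases p)
  have z: "cmod z \<le> \<rho>" and h: "cmod h \<le> \<eta>" using p(1) by (auto simp: zh N_def)
  have ge: "u (G 0 0) \<le> \<psi> p" using p(2)[OF N(2)] by (simp add: \<psi>_def)
  have h': "cmod h < \<eta>"
  proof (rule ccontr)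
    assume "\<not> cmod h < \<eta>"
    with h have "cmod h = \<eta>" by simp
    then have "\<psi> p \<le> m - K * \<eta>\<^sup>2 + \<rho>\<^sup>2"
      using m[OF p(1)] z by (simp add: \<psi>_def zh power_mono add_mono)
    with K\<eta> ge show False by simp
  qed
  have "cmod z = \<rho>"
  proof (rule ccontr)
    assume "cmod z \<noteq> \<rho>"
    with z have z': "cmod z < \<rho>" by simp
    have "\<forall>\<^sub>F s in at_right 0. cmod z + s < \<rho>"
      by (rule order_tendstoD(2)[where y = "cmod z"]) (auto intro!: tendsto_eq_intros z')
    moreover have "\<forall>\<^sub>F s in at_right 0. cmod h + cmod q * s\<^sup>2 < \<eta>"
      by (rule order_tendstoD(2)[where y = "cmod h"]) (auto intro!: tendsto_eq_intros h')
    moreover have "\<forall>\<^sub>F s in at_right 0. K * (cmod q)\<^sup>2 * s\<^sup>2 < 1"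
      by (rule order_tendstoD(2)[where y = 0]) (auto intro!: tendsto_eq_intros)
    moreover have "\<forall>\<^sub>F s in at_right (0::real). 0 < s" by (rule eventually_at_right_less)
    ultimately have "\<forall>\<^sub>F s in at_right 0. cmod z + s < \<rho> \<and> cmod h + cmod q * s\<^sup>2 < \<eta> \<and>
        K * (cmod q)\<^sup>2 * s\<^sup>2 < 1 \<and> 0 < s"
      by eventually_elim simp
    then obtain s where s: "cmod z + s < \<rho>" "cmod h + cmod q * s\<^sup>2 < \<eta>" "K * (cmod q)\<^sup>2 * s\<^sup>2 < 1" "0 < s"
      using eventually_happens[of _ "at_right (0::real)"] by auto
    define V where "V = of_real s *s (X - (2 * q * z) *s Y)"
    \<comment> \<open>The change of \<open>h\<close> cancels the square of the change of
      \<open>z\<close> in \<open>h - q * z\<^sup>2\<close>, so the curve traced by \<open>G\<close>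
      is exactly an affine disc with direction \<open>V\<close>.\<close>
    define g where "g \<tau> = (z + of_real s * \<tau>, h + q * (of_real s * \<tau>)\<^sup>2)" for \<tau>
    have G_g: "G (fst (g \<tau>)) (snd (g \<tau>)) = G z h + \<tau> *s V" for \<tau>
      by (simp add: G_def g_def V_def vec_eq_iff power2_eq_square algebra_simps)
    have gN: "g \<tau> \<in> N" if "cmod \<tau> \<le> 1" for \<tau>
    proof -
      have "cmod (of_real s * \<tau>) \<le> s" using that s(4) by (simp add: norm_mult mult_left_le)
      moreover from this have "(cmod (of_real s * \<tau>))\<^sup>2 \<le> s\<^sup>2" by (intro power_mono) auto
      then have "cmod (q * (of_real s * \<tau>)\<^sup>2) \<le> cmod q * s\<^sup>2"
        by (simp only: norm_mult norm_power) (intro mult_left_mono, auto)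
      ultimately show ?thesis
        using s norm_triangle_ineq[of z "of_real s * \<tau>"] norm_triangle_ineq[of h "q * (of_real s * \<tau>)\<^sup>2"]
        by (simp add: g_def N_def)
    qed
    have "\<forall>\<tau>. cmod \<tau> \<le> 1 \<longrightarrow> G z h + \<tau> *s V \<in> \<Omega>"
      using G_in[OF gN] by (simp add: G_g)
    then have mean: "u (G z h) \<le> integral {0..2 * pi} (\<lambda>\<theta>. u (G z h + cis \<theta> *s V)) / (2 * pi)"
      using u unfolding continuous_plurisubharmonic_on_def by blast
    \<comment> \<open>Maximality at \<open>p\<close> bounds \<open>u\<close> on the circle by this
      expression. The terms in \<open>cis \<theta>\<close> and its square have mean zero. What
      remains is \<open>K * (cmod q)\<^sup>2 * s ^ 4 - s\<^sup>2\<close>, which is negative by the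
      choice of \<open>s\<close> and contradicts the mean value inequality.\<close>
    define \<phi> where "\<phi> \<theta> = (u (G z h) + K * (cmod q)\<^sup>2 * s ^ 4 - s\<^sup>2)
        + (Re ((2 * of_real K * cnj h * q * (of_real s)\<^sup>2) * cis (real 2 * \<theta>)) -
           Re ((2 * cnj z * of_real s) * cis (real 1 * \<theta>)))" for \<theta>
    have le: "u (G z h + cis \<theta> *s V) \<le> \<phi> \<theta>" for \<theta>
    proof -
      have c2: "cis (real 2 * \<theta>) = (cis \<theta>)\<^sup>2" by (simp add: cis_mult power2_eq_square)
      have "\<psi> (g (cis \<theta>)) \<le> \<psi> p" by (rule p(2)[OF gN]) simp
      then have "u (G z h + cis \<theta> *s V) \<le> u (G z h) - K * (cmod h)\<^sup>2 + (cmod z)\<^sup>2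
          + K * (cmod (h + q * (of_real s * cis \<theta>)\<^sup>2))\<^sup>2 - (cmod (z + of_real s * cis \<theta>))\<^sup>2"
        by (simp add: \<psi>_def zh flip: G_g) (simp add: g_def)
      also have "\<dots> = \<phi> \<theta>"
        unfolding cmod_add_square \<phi>_def c2
        by (simp add: norm_mult norm_power power_mult_distrib algebra_simps power2_eq_square power4_eq_xxxx)
      finally show ?thesis .
    qed
    have int_\<phi>: "(\<phi> has_integral ((u (G z h) + K * (cmod q)\<^sup>2 * s ^ 4 - s\<^sup>2) * (2 * pi) + (0 - 0))) {0..2 * pi}"
      unfolding \<phi>_def[abs_def]
      by (intro has_integral_add has_integral_diff has_integral_Re_cis_multiple)
        (use has_integral_const_real[of "u (G z h) + K * (cmod q)\<^sup>2 * s ^ 4 - s\<^sup>2" 0 "2 * pi"] in \<open>auto simp: mult.commute\<close>)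
    have "continuous_on {0..2 * pi} (\<lambda>\<theta>. u (G (fst (g (cis \<theta>))) (snd (g (cis \<theta>)))))"
      by (rule continuous_on_compose2[OF cont_v, of _ "\<lambda>\<theta>. g (cis \<theta>)"])
        (auto simp: g_def[abs_def] intro!: continuous_intros gN[unfolded g_def])
    then have "(\<lambda>\<theta>. u (G z h + cis \<theta> *s V)) integrable_on {0..2 * pi}"
      unfolding G_g by (rule integrable_continuous_real)
    then have "integral {0..2 * pi} (\<lambda>\<theta>. u (G z h + cis \<theta> *s V)) \<le> (u (G z h) + K * (cmod q)\<^sup>2 * s ^ 4 - s\<^sup>2) * (2 * pi)"
      using integral_le[OF _ has_integral_integrable[OF int_\<phi>] le] integral_unique[OF int_\<phi>] by simp
    then have "integral {0..2 * pi} (\<lambda>\<theta>. u (G z h + cis \<theta> *s V)) / (2 * pi) \<le> u (G z h) + K * (cmod q)\<^sup>2 * s ^ 4 - s\<^sup>2"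
      by (simp add: divide_le_eq)
    with mean have "s\<^sup>2 * 1 \<le> s\<^sup>2 * (K * (cmod q)\<^sup>2 * s\<^sup>2)" by (simp add: power4_eq_xxxx power2_eq_square algebra_simps)
    with s(3,4) show False by simp
  qed
  moreover have "u (G 0 0) \<le> u (G z h) + \<rho>\<^sup>2"
  proof -
    have "\<psi> p \<le> u (G z h) + \<rho>\<^sup>2"
      using K z by (simp add: \<psi>_def zh) (smt (verit) mult_nonneg_nonneg power_mono norm_ge_zero zero_le_power2)
    with ge show ?thesis by simp
  qed
  ultimately show ?thesis using h by blast
qed

lemma norm_smult_complex_le:
  fixes X :: "complex ^ 'n"
  obtains C where "0 \<le> C" "\<And>z. norm (z *s X) \<le> cmod z * C"
proof -
  show thesis
    using bounded_linear.nonneg_bounded[OF bounded_linear_smult_left, of X] that by blast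
qed

text \<open>In coordinates \<open>z X + w Y\<close> the defining function is
  \<open>Re w + Re (q z\<^sup>2) + L |z|\<^sup>2\<close> up to higher order terms, where \<open>L < 0\<close> is the Levi form;
  the substitution \<open>w = h - q z\<^sup>2\<close> removes the pluriharmonic term \<open>Re (q z\<^sup>2)\<close>.\<close>

lemma levi_negative_normal_form:
  fixes b X Y :: "complex ^ 'n"
  assumes "open U" "b \<in> U" and dr: "\<And>x. x \<in> U \<Longrightarrow> (r has_derivative blinfun_apply (r' x)) (at x)"
    and dr': "(r' has_derivative blinfun_apply B) (at b)" and "r b = 0"
    and neg: "levi_negative (r' b) B X" and Y: "complexify (r' b) Y = 1"
  obtains q \<rho> L where "0 < \<rho>" "0 < L"
    "\<And>z h. cmod z \<le> \<rho> \<Longrightarrow> cmod h \<le> \<rho> \<Longrightarrow> b + z *s X + (h - q * z\<^sup>2) *s Y \<in> U \<and>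
        r (b + z *s X + (h - q * z\<^sup>2) *s Y) \<le> Re h + cmod h / 4 - L * (cmod z)\<^sup>2"
proof -
  let ?I = "\<i> *s X"
  define l where "l = - (B X X + B ?I ?I) / 4"
  have l: "0 < l" using neg by (simp add: l_def levi_negative_def)
  \<comment> \<open>The real quadratic form \<open>B (z *s X) (z *s X) / 2\<close> splits into the
    real part of a holomorphic square, with coefficient \<open>q\<close>, and the multiple
    \<open>- l\<close> of the squared modulus.\<close>
  define q where "q = Complex ((B X X - B ?I ?I) / 4) (- (B X ?I + B ?I X) / 4)"
  have quad: "B (z *s X) (z *s X) / 2 = Re (q * z\<^sup>2) - l * (cmod z)\<^sup>2" for z
    unfolding cmod_power2 by (subst (1 2) vector_smult_complex)
      (simp add: q_def l_def blinfun.bilinear_simps power2_eq_square field_simps)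
  have lin: "r' b (z *s X + w *s Y) = Re w" for z w
  proof -
    have "complexify (r' b) X = 0" using neg by (simp add: levi_negative_def complex_eq_iff)
    then have "complexify (r' b) (z *s X + w *s Y) = w" by (simp add: complexify_add complexify_smult Y)
    then show ?thesis by (simp add: complex_eq_iff)
  qed
  obtain NX where NX: "0 \<le> NX" "\<And>z. norm (z *s X) \<le> cmod z * NX" using norm_smult_complex_le by blast
  obtain NY where NY: "0 \<le> NY" "\<And>z. norm (z *s Y) \<le> cmod z * NY" using norm_smult_complex_le by blast
  obtain M where M: "0 \<le> M" "\<And>v w. norm (B v w) \<le> norm v * norm w * M"
  proof -
    have "norm (B v w) \<le> norm v * norm w * norm B" for v w
      using norm_blinfun[of "B v" w] mult_right_mono[OF norm_blinfun[of B v], of "norm w"]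
      by (simp add: mult_ac)
    then show thesis using that[of "norm B"] by simp
  qed
  \<comment> \<open>The budget for the gain \<open>l * (cmod z)\<^sup>2\<close>: a quarter is spent
    on the Taylor error, a quarter on the terms containing \<open>w\<close>, and the remaining half
    is the \<open>L\<close> of the conclusion.\<close>
  define e where "e = l / (8 * (NX\<^sup>2 + 1))"
  have e: "0 < e" using l by (simp add: e_def add_nonneg_pos)
  have eNX: "2 * e * NX\<^sup>2 \<le> l / 4"
  proof -
    define S where "S = NX\<^sup>2 + 1"
    have "0 < S" by (simp add: S_def add_nonneg_pos)
    then have "e * S = l / 8" unfolding e_def S_def[symmetric] by simp
    then show ?thesis using e by (simp add: S_def algebra_simps)
  qed
  obtain d where d: "0 < d"
    "\<And>v. norm v < d \<Longrightarrow> b + v \<in> U \<and> \<bar>r (b + v) - r b - r' b v - B v v / 2\<bar> \<le> e * (norm v)\<^sup>2"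
    using second_order_taylor[OF assms(1,2) dr dr' e] by blast
  define C1 where "C1 = M * NX * NY"
  define C2 where "C2 = M * NY\<^sup>2 / 2 + 2 * e * NY\<^sup>2"
  define Q where "Q = cmod q"
  have C: "0 \<le> C1" "0 \<le> C2" "0 \<le> Q" using M NX NY e by (auto simp: C1_def C2_def Q_def)
  \<comment> \<open>The terms containing \<open>w\<close> will be at most
    \<open>cmod w * \<kappa>\<close>. As \<open>w\<close> is bounded by
    \<open>cmod h + Q * (cmod z)\<^sup>2\<close>, this \<open>\<kappa>\<close> leaves
    \<open>cmod h / 4\<close> and a quarter of the gain.\<close>
  define \<kappa> where "\<kappa> = min (1 / 4) (l / (4 * (Q + 1)))"
  have \<kappa>: "0 < \<kappa>" "\<kappa> \<le> 1 / 4" "Q * \<kappa> \<le> l / 4"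
  proof -
    show "0 < \<kappa>" using l C by (simp add: \<kappa>_def)
    show "\<kappa> \<le> 1 / 4" unfolding \<kappa>_def by (rule min.cobounded1)
    have "Q * \<kappa> \<le> Q * (l / (4 * (Q + 1)))" using C by (intro mult_left_mono) (auto simp: \<kappa>_def)
    also have "\<dots> \<le> l / 4" using l C by (simp add: field_simps)
    finally show "Q * \<kappa> \<le> l / 4" .
  qed
  define A1 where "A1 = C1 + C2 * (1 + Q)"
  define A2 where "A2 = NX + (1 + Q) * NY"
  have A: "0 \<le> A1" "0 \<le> A2" using C NX NY by (auto simp: A1_def A2_def)
  define \<rho> where "\<rho> = min 1 (min (\<kappa> / (A1 + 1)) (d / (2 * (A2 + 1))))"
  have \<rho>: "0 < \<rho>" "\<rho> \<le> 1" using \<kappa> A d by (auto simp: \<rho>_def)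
  have \<rho>A1: "\<rho> * A1 \<le> \<kappa>"
  proof -
    have "\<rho> * A1 \<le> \<kappa> / (A1 + 1) * A1" using A by (intro mult_right_mono) (auto simp: \<rho>_def)
    also have "\<dots> \<le> \<kappa>" using A \<kappa> by (simp add: field_simps)
    finally show ?thesis .
  qed
  have \<rho>A2: "\<rho> * A2 < d"
  proof -
    have "\<rho> * A2 \<le> d / (2 * (A2 + 1)) * A2" using A by (intro mult_right_mono) (auto simp: \<rho>_def)
    also have "\<dots> < d"
    proof -
      have "0 < A2 * d + d * 2" using A d(1) by (intro add_nonneg_pos) auto
      then show ?thesis using A d(1) by (simp add: field_simps)
    qed
    finally show ?thesis .
  qed
  show thesis
  proof (rule that)
    show "0 < \<rho>" "0 < l / 2" using \<rho> l by auto
    fix z h :: complex assume z: "cmod z \<le> \<rho>" and h: "cmod h \<le> \<rho>"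
    define w where "w = h - q * z\<^sup>2"
    define v where "v = z *s X + w *s Y"
    have w1: "cmod w \<le> cmod h + Q * (cmod z)\<^sup>2"
      unfolding w_def Q_def using norm_triangle_ineq4[of h "q * z\<^sup>2"] by (simp add: norm_mult norm_power)
    have "(cmod z)\<^sup>2 \<le> \<rho> * 1" unfolding power2_eq_square using z \<rho> by (intro mult_mono) auto
    then have w2: "cmod w \<le> \<rho> * (1 + Q)"
      using w1 h mult_left_mono[of "(cmod z)\<^sup>2" \<rho> Q] C by (simp add: algebra_simps)
    have nv: "norm v \<le> cmod z * NX + cmod w * NY"
      unfolding v_def by (intro norm_triangle_le add_mono NX NY)
    also have "\<dots> \<le> \<rho> * NX + \<rho> * (1 + Q) * NY" using z w2 NX NY by (intro add_mono mult_right_mono) auto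
    also have "\<dots> = \<rho> * A2" by (simp add: A2_def algebra_simps)
    finally have "norm v < d" using \<rho>A2 by simp
    note dv = d(2)[OF this]
    have "(norm v)\<^sup>2 \<le> (cmod z * NX + cmod w * NY)\<^sup>2" using nv by (intro power_mono) auto
    also have "\<dots> \<le> 2 * (cmod z * NX)\<^sup>2 + 2 * (cmod w * NY)\<^sup>2"
      using sum_squares_bound[of "cmod z * NX" "cmod w * NY"] by (simp add: power2_sum)
    finally have "e * (norm v)\<^sup>2 \<le> e * (2 * (cmod z * NX)\<^sup>2 + 2 * (cmod w * NY)\<^sup>2)"
      using e by (intro mult_left_mono) auto
    also have "\<dots> = (2 * e * NX\<^sup>2) * (cmod z)\<^sup>2 + 2 * e * NY\<^sup>2 * (cmod w)\<^sup>2"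
      by (simp add: power_mult_distrib algebra_simps)
    also have "\<dots> \<le> l / 4 * (cmod z)\<^sup>2 + 2 * e * NY\<^sup>2 * (cmod w)\<^sup>2"
      by (intro add_mono mult_right_mono[OF eNX] order_refl) auto
    finally have err: "e * (norm v)\<^sup>2 \<le> l / 4 * (cmod z)\<^sup>2 + 2 * e * NY\<^sup>2 * (cmod w)\<^sup>2" .
    have cross: "B (x *s V) (y *s W) \<le> (cmod x * NV) * (cmod y * NW) * M"
      if "\<And>z. norm (z *s V) \<le> cmod z * NV" "\<And>z. norm (z *s W) \<le> cmod z * NW" "0 \<le> NV" "0 \<le> NW" for x y V W NV NW
    proof -
      have "norm (x *s V) * norm (y *s W) * M \<le> (cmod x * NV) * (cmod y * NW) * M"
        using that M by (intro mult_right_mono mult_mono) auto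
      then show ?thesis using M(2)[of "x *s V" "y *s W"] by simp
    qed
    have "B v v = B (z *s X) (z *s X) + B (z *s X) (w *s Y) + B (w *s Y) (z *s X) + B (w *s Y) (w *s Y)"
      by (simp add: v_def blinfun.bilinear_simps)
    also have "\<dots> \<le> B (z *s X) (z *s X) + (cmod z * NX) * (cmod w * NY) * M
        + (cmod w * NY) * (cmod z * NX) * M + (cmod w * NY) * (cmod w * NY) * M"
      by (intro add_mono cross NX NY order_refl)
    finally have "B v v / 2 \<le> B (z *s X) (z *s X) / 2 + C1 * (cmod z * cmod w) + M * NY\<^sup>2 / 2 * (cmod w)\<^sup>2"
      by (simp add: C1_def power2_eq_square algebra_simps)
    then have "r (b + v) \<le> Re w + Re (q * z\<^sup>2) - l * (cmod z)\<^sup>2 + C1 * (cmod z * cmod w) + M * NY\<^sup>2 / 2 * (cmod w)\<^sup>2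
        + (l / 4 * (cmod z)\<^sup>2 + 2 * e * NY\<^sup>2 * (cmod w)\<^sup>2)"
      using dv err quad[of z] lin[of z w] \<open>r b = 0\<close> unfolding v_def by (simp add: abs_le_iff)
    also have "\<dots> = Re h - 3 / 4 * l * (cmod z)\<^sup>2 + cmod w * (C1 * cmod z + C2 * cmod w)"
      by (simp add: w_def C2_def power2_eq_square algebra_simps)
    also have "cmod w * (C1 * cmod z + C2 * cmod w) \<le> cmod w * \<kappa>"
    proof (rule mult_left_mono)
      have "C1 * cmod z + C2 * cmod w \<le> C1 * \<rho> + C2 * (\<rho> * (1 + Q))"
        using z w2 C by (intro add_mono mult_left_mono) auto
      also have "\<dots> = \<rho> * A1" by (simp add: A1_def algebra_simps)
      finally show "C1 * cmod z + C2 * cmod w \<le> \<kappa>" using \<rho>A1 by simp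
    qed simp
    also have "cmod w * \<kappa> \<le> cmod h * (1 / 4) + (cmod z)\<^sup>2 * (l / 4)"
    proof -
      have "cmod w * \<kappa> \<le> (cmod h + Q * (cmod z)\<^sup>2) * \<kappa>" using w1 \<kappa> by (intro mult_right_mono) auto
      also have "\<dots> = cmod h * \<kappa> + (cmod z)\<^sup>2 * (Q * \<kappa>)" by (simp add: algebra_simps)
      also have "\<dots> \<le> cmod h * (1 / 4) + (cmod z)\<^sup>2 * (l / 4)" using \<kappa> by (intro add_mono mult_left_mono) auto
      finally show ?thesis .
    qed
    finally have "r (b + v) \<le> Re h + cmod h / 4 - l / 2 * (cmod z)\<^sup>2" by (simp add: algebra_simps)
    then show "b + z *s X + (h - q * z\<^sup>2) *s Y \<in> U \<and>
        r (b + z *s X + (h - q * z\<^sup>2) *s Y) \<le> Re h + cmod h / 4 - l / 2 * (cmod z)\<^sup>2"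
      using dv by (simp add: v_def w_def add.assoc)
  qed
qed

lemma matrix_vector_smult_affine:
  fixes A :: "complex ^ 'm ^ 'n"
  shows "p + A *v (b0 + z *s X0 + w *s Y0) = (p + A *v b0) + z *s (A *v X0) + w *s (A *v Y0)"
  by (simp add: matrix_vector_right_distrib vector_scalar_commute)

text \<open>The continuity principle: parabolic discs in \<open>P\<close> lie in \<open>D\<close>
  with their rims in one compact subset of \<open>D\<close>, while their centres tend to
  \<open>b\<close>. A plurisubharmonic exhaustion function is then bounded at the centres, so they
  stay in a compact subset of \<open>D\<close>, which would force \<open>b\<close> into
  \<open>D\<close>.\<close>

lemma levi_negative_section_not_pseudoconvex:
  fixes D :: "(complex ^ 'n) set"
  assumes "open D" and chart: "C2_chart D U r r' r''" and b: "b \<in> frontier D" "b \<in> U"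
    and neg: "levi_negative (r' b) (r'' b) X" and Y: "complexify (r' b) Y = 1"
    and P: "P = range (\<lambda>(z, w). b + z *s X + w *s Y)"
  shows "P \<inter> D \<noteq> {}" "\<not> pseudoconvex_in_plane P (P \<inter> D)"
proof -
  note c = C2_chartD[OF chart]
  have "r b = 0" using c(6) b by blast
  obtain q \<rho> L where \<rho>: "0 < \<rho>" and "0 < L"
    and nf: "\<And>z h. cmod z \<le> \<rho> \<Longrightarrow> cmod h \<le> \<rho> \<Longrightarrow> b + z *s X + (h - q * z\<^sup>2) *s Y \<in> U \<and>
        r (b + z *s X + (h - q * z\<^sup>2) *s Y) \<le> Re h + cmod h / 4 - L * (cmod z)\<^sup>2"
    using levi_negative_normal_form[OF c(1) b(2) c(2) c(3)[OF b(2)] \<open>r b = 0\<close> neg Y] by metis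
  define G where "G z h = b + z *s X + (h - q * z\<^sup>2) *s Y" for z h
  have G_P: "G z h \<in> P" for z h unfolding P G_def by (rule range_eqI[of _ _ "(z, h - q * z\<^sup>2)"]) simp
  have G_D: "G z h \<in> D" if "cmod z \<le> \<rho>" "cmod h \<le> \<rho>" "Re h + cmod h / 4 < L * (cmod z)\<^sup>2" for z h
    using nf[OF that(1,2)] that(3) c(5) unfolding G_def by force
  \<comment> \<open>On the rim the Levi term gives room \<open>L * \<rho>\<^sup>2\<close>, at least
    \<open>2 * \<epsilon>1\<close>, while the terms in \<open>h\<close> use at most
    \<open>5 / 4 * \<epsilon>1\<close>.\<close>
  define \<epsilon>1 where "\<epsilon>1 = min \<rho> (L * \<rho>\<^sup>2 / 2)"
  have \<epsilon>1: "0 < \<epsilon>1" "\<epsilon>1 \<le> \<rho>" using \<rho> \<open>0 < L\<close> by (auto simp: \<epsilon>1_def)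
  have rim: "G z h \<in> D" if "cmod z = \<rho>" "cmod h \<le> \<epsilon>1" for z h
  proof (rule G_D)
    have "Re h + cmod h / 4 \<le> 5 / 4 * \<epsilon>1" using complex_Re_le_cmod[of h] that by simp
    also have "\<dots> < 2 * \<epsilon>1" using \<epsilon>1 by simp
    also have "\<dots> \<le> L * (cmod z)\<^sup>2" using that by (simp add: \<epsilon>1_def)
    finally show "Re h + cmod h / 4 < L * (cmod z)\<^sup>2" .
  qed (use that \<epsilon>1 in auto)
  \<comment> \<open>The discs at level \<open>- \<epsilon>\<close> may be thickened by
    \<open>\<epsilon> / 4\<close>: the real part is then at most
    \<open>- 3 / 4 * \<epsilon>\<close>, and the quarter of the modulus adds at most
    \<open>5 / 16 * \<epsilon>\<close>.\<close>
  have disc: "G z (h - of_real \<epsilon>) \<in> D"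
    if "0 < \<epsilon>" "\<epsilon> \<le> \<epsilon>1 / 2" "cmod z \<le> \<rho>" "cmod h \<le> \<epsilon> / 4" for z h \<epsilon>
  proof (rule G_D)
    have n: "cmod (h - of_real \<epsilon>) \<le> 5 / 4 * \<epsilon>"
      using norm_triangle_ineq4[of h "of_real \<epsilon>"] that by simp
    then show "cmod (h - of_real \<epsilon>) \<le> \<rho>" using that \<epsilon>1 by simp
    have "Re (h - of_real \<epsilon>) + cmod (h - of_real \<epsilon>) / 4 \<le> (\<epsilon> / 4 - \<epsilon>) + (5 / 4 * \<epsilon>) / 4"
      using complex_Re_le_cmod[of h] n that by (intro add_mono divide_right_mono) auto
    also have "\<dots> < 0" using that by simp
    also have "0 \<le> L * (cmod z)\<^sup>2" using \<open>0 < L\<close> by simp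
    finally show "Re (h - of_real \<epsilon>) + cmod (h - of_real \<epsilon>) / 4 < L * (cmod z)\<^sup>2" .
  qed fact
  have "G 0 (0 - of_real (\<epsilon>1 / 2)) \<in> D" by (rule disc) (use \<epsilon>1 \<rho> in auto)
  then show "P \<inter> D \<noteq> {}" using G_P by blast
  show "\<not> pseudoconvex_in_plane P (P \<inter> D)"
  proof
    assume "pseudoconvex_in_plane P (P \<inter> D)"
    then obtain p and A :: "complex ^ 2 ^ 'n" where A: "range (\<lambda>z. p + A *v z) = P"
      and pc: "pseudoconvex {z. p + A *v z \<in> P \<inter> D}"
      unfolding pseudoconvex_in_plane_def by blast
    define \<Omega> where "\<Omega> = {z. p + A *v z \<in> D}"
    have "{z. p + A *v z \<in> P \<inter> D} = \<Omega>" using A by (auto simp: \<Omega>_def)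
    then obtain u where u: "continuous_plurisubharmonic_on \<Omega> u"
      and exh: "\<And>k. \<exists>K. compact K \<and> K \<subseteq> \<Omega> \<and> {z \<in> \<Omega>. u z < k} \<subseteq> K"
      using pc unfolding pseudoconvex_def by auto
    have "b \<in> P" unfolding P by (rule range_eqI[of _ _ "(0, 0)"]) simp
    moreover have "b + X \<in> P" unfolding P by (rule range_eqI[of _ _ "(1, 0)"]) simp
    moreover have "b + Y \<in> P" unfolding P by (rule range_eqI[of _ _ "(0, 1)"]) simp
    ultimately have "\<exists>z. p + A *v z = b" "\<exists>z. p + A *v z = b + X" "\<exists>z. p + A *v z = b + Y"
      unfolding A[symmetric] by auto
    then obtain b0 x1 y1 where pts: "p + A *v b0 = b" "p + A *v x1 = b + X" "p + A *v y1 = b + Y"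
      by (elim exE)
    \<comment> \<open>The coordinates on \<open>P\<close> come from the pseudoconvexity hypothesis
      and are arbitrary, so the directions \<open>X\<close> and \<open>Y\<close> are pulled back to
      them; \<open>F\<close> is \<open>G\<close> in these coordinates.\<close>
    define X0 where "X0 = x1 - b0"
    define Y0 where "Y0 = y1 - b0"
    have "A *v X0 = (p + A *v x1) - (p + A *v b0)" "A *v Y0 = (p + A *v y1) - (p + A *v b0)"
      by (simp_all add: X0_def Y0_def matrix_vector_mult_diff_distrib)
    then have X0: "A *v X0 = X" and Y0: "A *v Y0 = Y" unfolding pts by simp_all
    define F where "F z h = b0 + z *s X0 + (h - q * z\<^sup>2) *s Y0" for z h
    have F_iff: "F z h \<in> \<Omega> \<longleftrightarrow> G z h \<in> D" for z h
      unfolding F_def G_def \<Omega>_def mem_Collect_eq matrix_vector_smult_affine pts X0 Y0 ..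
    have cont_F: "continuous_on S (\<lambda>x. F (f x) (g x))" if "continuous_on S f" "continuous_on S g"
      for S :: "'x::topological_space set" and f g
      unfolding F_def
      by (intro continuous_intros bounded_linear.continuous_on[OF bounded_linear_smult_left] that)
    have cont_u: "continuous_on \<Omega> u" using u by (simp add: continuous_plurisubharmonic_on_def)
    let ?R = "sphere (0::complex) \<rho> \<times> cball (0::complex) \<epsilon>1"
    have "compact ?R" by (intro compact_Times) auto
    moreover have "continuous_on ?R (\<lambda>x. u (F (fst x) (snd x)))"
    proof (rule continuous_on_compose2[OF cont_u])
      show "continuous_on ?R (\<lambda>x. F (fst x) (snd x))" by (intro cont_F continuous_intros)
      show "(\<lambda>x. F (fst x) (snd x)) ` ?R \<subseteq> \<Omega>" using rim by (auto simp: F_iff)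
    qed
    ultimately have "bounded ((\<lambda>x. u (F (fst x) (snd x))) ` ?R)"
      by (intro compact_imp_bounded compact_continuous_image)
    then obtain m where m: "\<And>x. x \<in> ?R \<Longrightarrow> u (F (fst x) (snd x)) \<le> m"
      unfolding bounded_real by (meson abs_le_D1 imageI)
    have low: "F 0 (- of_real \<epsilon>) \<in> \<Omega> \<and> u (F 0 (- of_real \<epsilon>)) < m + \<rho>\<^sup>2 + 1"
      if \<epsilon>: "0 < \<epsilon>" "\<epsilon> \<le> \<epsilon>1 / 2" for \<epsilon>
    proof -
      have "b0 + z *s X0 + (h - of_real \<epsilon> - q * z\<^sup>2) *s Y0 \<in> \<Omega>" if "cmod z \<le> \<rho>" "cmod h \<le> \<epsilon> / 4" for z h
        using disc[OF \<epsilon> that] by (simp flip: F_iff) (simp add: F_def)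
      from plurisubharmonic_parabolic_disc[where \<eta> = "\<epsilon> / 4", OF u \<rho> _ this] \<epsilon>(1)
      have "\<exists>z h. cmod z = \<rho> \<and> cmod h \<le> \<epsilon> / 4 \<and>
          u (F 0 (- of_real \<epsilon>)) \<le> u (F z (h - of_real \<epsilon>)) + \<rho>\<^sup>2"
        by (simp add: F_def)
      then obtain z h where zh: "cmod z = \<rho>" "cmod h \<le> \<epsilon> / 4"
        "u (F 0 (- of_real \<epsilon>)) \<le> u (F z (h - of_real \<epsilon>)) + \<rho>\<^sup>2"
        by blast
      have "cmod (h - of_real \<epsilon>) \<le> \<epsilon>1"
        using norm_triangle_ineq4[of h "of_real \<epsilon>"] zh \<epsilon> by simp
      then have "u (F z (h - of_real \<epsilon>)) \<le> m" using m[of "(z, h - of_real \<epsilon>)"] zh by simp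
      moreover have "F 0 (- of_real \<epsilon>) \<in> \<Omega>"
        using disc[OF \<epsilon>, of 0 0] \<rho> \<epsilon> by (simp add: F_iff)
      ultimately show ?thesis using zh(3) by simp
    qed
    obtain K where K: "compact K" "K \<subseteq> \<Omega>" "{z \<in> \<Omega>. u z < m + \<rho>\<^sup>2 + 1} \<subseteq> K" using exh by blast
    have "\<forall>\<^sub>F \<epsilon> in at_right 0. F 0 (- of_real \<epsilon>) \<in> K"
      using low K(3) \<epsilon>1 by (intro eventually_at_rightI[of 0 "\<epsilon>1 / 2"]) auto
    moreover have "((\<lambda>\<epsilon>. F 0 (- of_real \<epsilon>)) \<longlongrightarrow> F 0 0) (at_right 0)"
    proof -
      have "continuous_on UNIV (\<lambda>\<epsilon>. F 0 (- of_real \<epsilon>))" by (intro cont_F continuous_intros)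
      then have "isCont (\<lambda>\<epsilon>. F 0 (- of_real \<epsilon>)) 0" by (simp add: continuous_on_eq_continuous_at)
      then have "((\<lambda>\<epsilon>. F 0 (- of_real \<epsilon>)) \<longlongrightarrow> F 0 0) (at 0)" by (simp add: isCont_def)
      then show ?thesis by (rule filterlim_mono) (auto simp: at_le)
    qed
    ultimately have "F 0 0 \<in> K"
      using Lim_in_closed_set[OF compact_imp_closed[OF K(1)]] by force
    then have "b \<in> D" using K(2) F_iff[of 0 0] by (auto simp: G_def)
    then show False using b(1) \<open>open D\<close> by (simp add: frontier_def interior_open)
  qed
qed

lemma complex_plane_range:
  fixes X Y :: "complex ^ 'n"
  assumes X: "X \<noteq> 0" and indep: "\<And>z. Y \<noteq> z *s X"
  shows "complex_plane (range (\<lambda>(z, w). b + z *s X + w *s Y))"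
proof -
  let ?V = "vec.span {X, Y}"
  have "vec.independent {X}" using X by simp
  moreover have "Y \<notin> vec.span {X}" using indep by (auto simp: vec.span_singleton)
  ultimately have "vec.independent {Y, X}" by (simp add: vec.independent_insert)
  moreover have "Y \<noteq> X" using indep[of 1] by simp
  ultimately have "vec.dim ?V = 2"
    using vec.dim_span_eq_card_independent[of "{Y, X}"] by (simp add: insert_commute)
  moreover have "range (\<lambda>(z, w). b + z *s X + w *s Y) = (+) b ` ?V"
  proof -
    have "x \<in> ?V \<longleftrightarrow> (\<exists>z w. x = z *s X + w *s Y)" for x
      by (simp add: vec.span_breakdown_eq vec.span_singleton image_iff diff_eq_eq add.commute)
    then have "?V = range (\<lambda>(z, w). z *s X + w *s Y)" by (auto simp: image_iff)
    then show ?thesis by (simp add: image_image case_prod_unfold add.assoc)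
  qed
  ultimately show ?thesis unfolding complex_plane_def using vec.subspace_span by blast
qed

lemma exceptional_point_imp_tangential:
  fixes D :: "(complex ^ 'n) set"
  assumes "open D" and chart: "C2_chart D U r r' r''" and b: "b \<in> frontier D" "b \<in> U"
    and neg: "levi_negative (r' b) (r'' b) X" and exc: "exceptional_point D a"
  shows "r' b (b - a) = 0"
proof (rule ccontr)
  assume "r' b (b - a) \<noteq> 0"
  then have "complexify (r' b) (a - b) \<noteq> 0" by (auto simp: complex_eq_iff blinfun.bilinear_simps)
  moreover define k where "k = complexify (r' b) (a - b)"
  ultimately have k: "k \<noteq> 0" by simp
  \<comment> \<open>The normalisation is the one required by the normal form; the point
    \<open>a\<close> has coordinates \<open>(0, k)\<close> in the plane.\<close>
  define Y where "Y = (1 / k) *s (a - b)"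
  define P where "P = range (\<lambda>(z, w). b + z *s X + w *s Y)"
  have Y: "complexify (r' b) Y = 1" 
    unfolding Y_def complexify_smult k_def[symmetric] using k by simp
  have X0: "complexify (r' b) X = 0" using neg by (simp add: levi_negative_def complex_eq_iff)
  have "X \<noteq> 0" using neg by (auto simp: levi_negative_def)
  moreover have "Y \<noteq> z *s X" for z using Y X0 by (auto simp: complexify_smult)
  ultimately have "complex_plane P" unfolding P_def by (rule complex_plane_range)
  moreover have "a \<in> P"
    unfolding P_def by (rule range_eqI[of _ _ "(0, k)"]) (use k in \<open>simp add: Y_def vector_smult_assoc\<close>)
  ultimately have "P \<inter> D = {} \<or> pseudoconvex_in_plane P (P \<inter> D)"
    using exc unfolding exceptional_point_def by blast
  with levi_negative_section_not_pseudoconvex[OF assms(1) chart b neg Y P_def] show False by blast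
qed

section \<open>Lines through a null set\<close>

lemma hausdorff_null_cover:
  assumes "hausdorff_measure d Z = 0" "0 < \<delta>" "0 < e"
  obtains C :: "nat \<Rightarrow> 'a::metric_space set" where "Z \<subseteq> (\<Union>i. C i)" "\<And>i. bounded (C i)"
    "\<And>i. diameter (C i) \<le> \<delta>" "(\<Sum>i. if C i = {} then 0 else ennreal (diameter (C i) ^ d)) < e"
proof -
  have "hausdorff_premeasure d \<delta> Z \<le> hausdorff_measure d Z"
    unfolding hausdorff_measure_def by (rule SUP_upper) (use assms in simp)
  then have "hausdorff_premeasure d \<delta> Z < e" using assms by simp
  then show thesis
    unfolding hausdorff_premeasure_def INF_less_iff using that by blast
qed

lemma card_ints_abs_le:
  assumes "0 \<le> B"
  shows "finite {i::int. \<bar>real_of_int i\<bar> \<le> B}" "real (card {i::int. \<bar>real_of_int i\<bar> \<le> B}) \<le> 2 * B + 1"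
proof -
  have eq: "{i::int. \<bar>real_of_int i\<bar> \<le> B} = {- \<lfloor>B\<rfloor>..\<lfloor>B\<rfloor>}"
    by (auto simp: abs_le_iff le_floor_iff) linarith+
  show "finite {i::int. \<bar>real_of_int i\<bar> \<le> B}" by (simp add: eq)
  have "0 \<le> \<lfloor>B\<rfloor>" using assms by simp
  then show "real (card {i::int. \<bar>real_of_int i\<bar> \<le> B}) \<le> 2 * B + 1"
    unfolding eq by (simp add: of_nat_nat)
qed

text \<open>Discretise \<open>t\<close> and \<open>s\<close> with mesh \<open>\<rho>\<close> and
  replace \<open>z\<close> by one point of \<open>C\<close>. Each parameter takes at most
  \<open>(2 * k + 3) / \<rho>\<close> values, and the balls have radius of order
  \<open>\<rho>\<close> in dimension \<open>d + 2\<close>, so the total volume is of order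
  \<open>\<rho> ^ d\<close>.\<close>

lemma swept_set_cover:
  fixes a n :: "'a::euclidean_space"
  assumes dim: "DIM('a) = d + 2" and "0 \<le> k" and C: "bounded C" "diameter C \<le> \<rho>" and "0 < \<rho>" "\<rho> \<le> 1"
  defines "M \<equiv> (2 * k + 3)\<^sup>2 * (unit_ball_vol (real (d + 2)) * (2 * k + norm n) ^ (d + 2))"
  shows "\<exists>T\<in>sets lebesgue. {a + t *\<^sub>R (z - a) + s *\<^sub>R n | z s t. z \<in> C \<and> norm (z - a) \<le> k \<and> \<bar>s\<bar> \<le> k \<and> \<bar>t\<bar> \<le> k} \<subseteq> T
    \<and> emeasure lebesgue T \<le> ennreal (M * \<rho> ^ d)"
proof (cases "\<exists>z\<in>C. norm (z - a) \<le> k")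
  case False
  then show ?thesis by (intro bexI[of _ "{}"]) auto
next
  case True
  then obtain z0 where z0: "z0 \<in> C" "norm (z0 - a) \<le> k" by blast
  define I where "I = {i::int. \<bar>real_of_int i\<bar> \<le> k / \<rho> + 1}"
  \<comment> \<open>The three errors at scale \<open>\<rho>\<close>: replacing \<open>z\<close> is
    weighted by \<open>t\<close> and costs \<open>k\<close>, rounding \<open>t\<close> is weighted
    by \<open>z0 - a\<close> and costs \<open>k\<close>, rounding \<open>s\<close> costs
    \<open>norm n\<close>.\<close>
  define K where "K = 2 * k + norm n"
  have K: "0 \<le> K" using \<open>0 \<le> k\<close> by (simp add: K_def)
  define B where "B = (\<lambda>(i, j). cball (a + (of_int i * \<rho>) *\<^sub>R (z0 - a) + (of_int j * \<rho>) *\<^sub>R n) (K * \<rho>))"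
  have Ic: "finite I" "real (card I) \<le> (2 * k + 3) / \<rho>"
  proof -
    have "0 \<le> k / \<rho> + 1" using assms by simp
    note c = card_ints_abs_le[OF this]
    show "finite I" using c(1) by (simp add: I_def)
    have "2 * (k / \<rho> + 1) + 1 \<le> (2 * k + 3) / \<rho>" using assms by (simp add: field_simps)
    with c(2) show "real (card I) \<le> (2 * k + 3) / \<rho>" unfolding I_def by (rule order_trans)
  qed
  have approx: "\<exists>i\<in>I. \<bar>t - of_int i * \<rho>\<bar> \<le> \<rho>" if "\<bar>t\<bar> \<le> k" for t
  proof (intro bexI)
    have "\<bar>t / \<rho> - of_int \<lfloor>t / \<rho>\<rfloor>\<bar> \<le> 1" by linarith
    moreover have "t - of_int \<lfloor>t / \<rho>\<rfloor> * \<rho> = (t / \<rho> - of_int \<lfloor>t / \<rho>\<rfloor>) * \<rho>" using \<open>0 < \<rho>\<close> by (simp add: field_simps)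
    ultimately show "\<bar>t - of_int \<lfloor>t / \<rho>\<rfloor> * \<rho>\<bar> \<le> \<rho>"
      using \<open>0 < \<rho>\<close> by (simp add: abs_mult mult_left_le_one_le)
    have "\<bar>t / \<rho>\<bar> \<le> k / \<rho>" using that \<open>0 < \<rho>\<close> by (simp add: divide_right_mono)
    then show "\<lfloor>t / \<rho>\<rfloor> \<in> I" unfolding I_def mem_Collect_eq by linarith
  qed
  show ?thesis
  proof (intro bexI conjI subsetI)
    let ?T = "\<Union>p\<in>I \<times> I. B p"
    show "?T \<in> sets lebesgue" using Ic(1) by (intro sets.finite_UN) (auto simp: B_def)
    have vol: "emeasure lebesgue (B p) = ennreal (unit_ball_vol (real (d + 2)) * (K * \<rho>) ^ (d + 2))" for p
      using K \<open>0 < \<rho>\<close> unfolding B_def by (cases p) (simp add: emeasure_cball dim del: power_Suc)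
    have "emeasure lebesgue ?T \<le> (\<Sum>p\<in>I \<times> I. emeasure lebesgue (B p))"
      using Ic(1) by (intro emeasure_subadditive_finite) (auto simp: B_def)
    also have "\<dots> = ennreal (real (card I) * real (card I) * (unit_ball_vol (real (d + 2)) * (K * \<rho>) ^ (d + 2)))"
      using K \<open>0 < \<rho>\<close> by (simp add: vol card_cartesian_product ennreal_of_nat_eq_real_of_nat flip: ennreal_mult' del: power_Suc)
    also have "\<dots> \<le> ennreal (((2 * k + 3) / \<rho>) * ((2 * k + 3) / \<rho>) * (unit_ball_vol (real (d + 2)) * (K * \<rho>) ^ (d + 2)))"
      using Ic K \<open>0 < \<rho>\<close> \<open>0 \<le> k\<close> by (intro ennreal_leI mult_right_mono mult_mono) auto
    also have "((2 * k + 3) / \<rho>) * ((2 * k + 3) / \<rho>) * (unit_ball_vol (real (d + 2)) * (K * \<rho>) ^ (d + 2)) = M * \<rho> ^ d"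
      using \<open>0 < \<rho>\<close> by (simp add: M_def K_def power_mult_distrib power_add power2_eq_square)
    finally show "emeasure lebesgue ?T \<le> ennreal (M * \<rho> ^ d)" .
    fix x assume "x \<in> {a + t *\<^sub>R (z - a) + s *\<^sub>R n | z s t. z \<in> C \<and> norm (z - a) \<le> k \<and> \<bar>s\<bar> \<le> k \<and> \<bar>t\<bar> \<le> k}"
    then obtain z s t where x: "x = a + t *\<^sub>R (z - a) + s *\<^sub>R n" and z: "z \<in> C" "\<bar>s\<bar> \<le> k" "\<bar>t\<bar> \<le> k" by blast
    obtain i j where ij: "i \<in> I" "j \<in> I" "\<bar>t - of_int i * \<rho>\<bar> \<le> \<rho>" "\<bar>s - of_int j * \<rho>\<bar> \<le> \<rho>"
      using approx[OF z(3)] approx[OF z(2)] by blast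
    let ?c = "a + (of_int i * \<rho>) *\<^sub>R (z0 - a) + (of_int j * \<rho>) *\<^sub>R n"
    have eq: "x - ?c = t *\<^sub>R (z - z0) + ((t - of_int i * \<rho>) *\<^sub>R (z0 - a) + (s - of_int j * \<rho>) *\<^sub>R n)"
      by (simp add: x algebra_simps)
    have "norm (z - z0) \<le> \<rho>"
      using diameter_bounded_bound[OF C(1) z(1) z0(1)] C(2) by (simp add: dist_norm)
    then have "norm (t *\<^sub>R (z - z0)) \<le> k * \<rho>" using z(3) by (simp add: mult_mono \<open>0 \<le> k\<close>)
    moreover have "norm ((t - of_int i * \<rho>) *\<^sub>R (z0 - a)) \<le> \<rho> * k"
      using ij(3) z0(2) \<open>0 < \<rho>\<close> unfolding norm_scaleR by (intro mult_mono) auto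
    moreover have "norm ((s - of_int j * \<rho>) *\<^sub>R n) \<le> \<rho> * norm n"
      using ij(4) unfolding norm_scaleR by (intro mult_right_mono) auto
    ultimately have "norm (x - ?c) \<le> k * \<rho> + (\<rho> * k + \<rho> * norm n)"
      unfolding eq by (intro norm_triangle_le add_mono) (auto intro: norm_triangle_le)
    also have "\<dots> = K * \<rho>" by (simp add: K_def algebra_simps)
    finally have "x \<in> B (i, j)" by (simp add: B_def dist_norm norm_minus_commute)
    then show "x \<in> ?T" using ij by blast
  qed
qed

text \<open>The pieces of a Hausdorff cover of \<open>Z\<close> are swept one by one; the volume of
  each swept piece is comparable to its term in the Hausdorff sum.\<close>

lemma negligible_swept_set_bounded:
  fixes Z :: "'a::euclidean_space set"
  assumes dim: "DIM('a) = d + 2" and H: "hausdorff_measure d Z = 0" and "0 \<le> k"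
  shows "negligible {a + t *\<^sub>R (z - a) + s *\<^sub>R n | z s t. z \<in> Z \<and> norm (z - a) \<le> k \<and> \<bar>s\<bar> \<le> k \<and> \<bar>t\<bar> \<le> k}"
    (is "negligible (?S Z)")
  unfolding negligible_outer
proof (intro allI impI)
  fix e :: real assume "0 < e"
  define M where "M = (2 * k + 3)\<^sup>2 * (unit_ball_vol (real (d + 2)) * (2 * k + norm n) ^ (d + 2))"
  have M: "0 \<le> M" using \<open>0 \<le> k\<close> by (simp add: M_def)
  define \<epsilon> where "\<epsilon> = min (1/2) (e / (4 * (M + 1)))"
  have \<epsilon>: "0 < \<epsilon>" "\<epsilon> < 1" using \<open>0 < e\<close> M by (auto simp: \<epsilon>_def)
  have Me: "M * (2 * \<epsilon>) < e"
  proof -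
    have "M * (2 * \<epsilon>) \<le> M * (2 * (e / (4 * (M + 1))))" using M by (intro mult_left_mono) (auto simp: \<epsilon>_def)
    also have "\<dots> < e" using M \<open>0 < e\<close> by (simp add: field_simps add_pos_nonneg)
    finally show ?thesis .
  qed
  obtain C where C: "Z \<subseteq> (\<Union>i. C i)" "\<And>i. bounded (C i)" "\<And>i. diameter (C i) \<le> 1 / 2"
      "(\<Sum>i. if C i = {} then 0 else ennreal (diameter (C i) ^ d)) < ennreal \<epsilon>"
    using hausdorff_null_cover[OF H, of "1/2" "ennreal \<epsilon>"] \<epsilon> by auto
  define h where "h i = (if C i = {} then 0 else ennreal (diameter (C i) ^ d))" for i
  have sh: "(\<Sum>i. h i) < ennreal \<epsilon>" using C(4) by (simp add: h_def)
  have "\<exists>T. T \<in> sets lebesgue \<and> ?S (C i) \<subseteq> T \<and>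
      emeasure lebesgue T \<le> ennreal M * (h i + ennreal (\<epsilon> * (1 / 2) ^ Suc i))" for i
  proof (cases "C i = {}")
    case True
    then show ?thesis by (intro exI[of _ "{}"]) auto
  next
    case False
    have hi: "h i = ennreal (diameter (C i) ^ d)" using False by (simp add: h_def)
    have "d \<noteq> 0"
    proof
      assume "d = 0"
      then have "1 \<le> h i" by (simp add: hi)
      also have "h i \<le> (\<Sum>i. h i)" using sum_le_suminf[of h "{i}"] by simp
      also have "\<dots> < 1" using sh \<epsilon> by (meson ennreal_less_one_iff order_less_trans)
      finally show False by simp
    qed
    have "0 \<le> diameter (C i)" using C(2) by (rule diameter_ge_0)
    \<comment> \<open>A piece may have diameter 0, whereas the cover needs a positive scale. So
      \<open>\<rho>\<close> is taken slightly above the diameter, at a cost whose sum over all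
      pieces is \<open>\<epsilon>\<close>; hence the total \<open>2 * \<epsilon>\<close>.\<close>
    have "((\<lambda>x. x ^ d) \<longlongrightarrow> diameter (C i) ^ d) (at_right (diameter (C i)))"
      by (intro tendsto_intros)
    then have "\<forall>\<^sub>F x in at_right (diameter (C i)). x ^ d < diameter (C i) ^ d + \<epsilon> * (1 / 2) ^ Suc i"
      by (rule order_tendstoD) (use \<epsilon> in simp)
    moreover have "\<forall>\<^sub>F x in at_right (diameter (C i)). x < 1"
      using C(3)[of i] by (intro eventually_at_rightI[of _ 1]) auto
    moreover have "\<forall>\<^sub>F x in at_right (diameter (C i)). diameter (C i) < x"
      by (rule eventually_at_right_less)
    ultimately have "\<forall>\<^sub>F x in at_right (diameter (C i)). x ^ d < diameter (C i) ^ d + \<epsilon> * (1 / 2) ^ Suc i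
        \<and> x < 1 \<and> diameter (C i) < x"
      by eventually_elim simp
    then obtain \<rho> where \<rho>: "\<rho> ^ d < diameter (C i) ^ d + \<epsilon> * (1 / 2) ^ Suc i" "\<rho> < 1" "diameter (C i) < \<rho>"
      using eventually_happens[of _ "at_right (diameter (C i))"] by auto
    have "0 < \<rho>" using \<rho>(3) \<open>0 \<le> diameter (C i)\<close> by linarith
    obtain T where T: "T \<in> sets lebesgue" "?S (C i) \<subseteq> T" "emeasure lebesgue T \<le> ennreal (M * \<rho> ^ d)"
      using swept_set_cover[OF dim \<open>0 \<le> k\<close> C(2), of i \<rho> a n] \<rho> \<open>0 < \<rho>\<close> unfolding M_def by force
    note T(3)
    also have "ennreal (M * \<rho> ^ d) \<le> ennreal (M * (diameter (C i) ^ d + \<epsilon> * (1 / 2) ^ Suc i))"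
      using M \<rho>(1) by (intro ennreal_leI mult_left_mono) auto
    also have "\<dots> = ennreal M * (h i + ennreal (\<epsilon> * (1 / 2) ^ Suc i))"
      using M \<epsilon> \<open>0 \<le> diameter (C i)\<close> by (simp add: hi ennreal_mult' ennreal_plus)
    finally show ?thesis using T(1,2) by (intro exI[of _ T] conjI)
  qed
  then have "\<forall>i. \<exists>T. T \<in> sets lebesgue \<and> ?S (C i) \<subseteq> T \<and>
      emeasure lebesgue T \<le> ennreal M * (h i + ennreal (\<epsilon> * (1 / 2) ^ Suc i))" by (rule allI)
  from choice[OF this] obtain T where T': "\<forall>i. T i \<in> sets lebesgue \<and> ?S (C i) \<subseteq> T i \<and>
      emeasure lebesgue (T i) \<le> ennreal M * (h i + ennreal (\<epsilon> * (1 / 2) ^ Suc i))" ..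
  note T = spec[OF T', THEN conjunct1] spec[OF T', THEN conjunct2, THEN conjunct1]
    spec[OF T', THEN conjunct2, THEN conjunct2]
  have "(\<lambda>i. \<epsilon> * (1 / 2) ^ Suc i) sums (\<epsilon> * 1)" by (intro sums_mult power_half_series)
  then have geo: "(\<Sum>i. ennreal (\<epsilon> * (1 / 2) ^ Suc i)) = ennreal \<epsilon>"
    using \<epsilon> by (intro suminf_ennreal_eq) auto
  have "emeasure lebesgue (\<Union>i. T i) \<le> (\<Sum>i. emeasure lebesgue (T i))"
    using T(1) by (intro emeasure_subadditive_countably) auto
  also have "\<dots> \<le> (\<Sum>i. ennreal M * (h i + ennreal (\<epsilon> * (1 / 2) ^ Suc i)))"
    using T(3) by (intro suminf_le) auto
  also have "\<dots> = ennreal M * ((\<Sum>i. h i) + ennreal \<epsilon>)"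
    by (simp only: ennreal_suminf_cmult suminf_add[OF summableI summableI, symmetric] geo)
  also have "\<dots> \<le> ennreal M * (ennreal \<epsilon> + ennreal \<epsilon>)"
    using sh by (intro mult_left_mono add_mono) auto
  also have "\<dots> = ennreal (M * (2 * \<epsilon>))" using M \<epsilon> by (simp add: ennreal_mult' ennreal_plus[symmetric] del: ennreal_plus)
  finally have le: "emeasure lebesgue (\<Union>i. T i) \<le> ennreal (M * (2 * \<epsilon>))" .
  show "\<exists>T. ?S Z \<subseteq> T \<and> T \<in> lmeasurable \<and> measure lebesgue T < e"
  proof (intro exI conjI)
    show "?S Z \<subseteq> (\<Union>i. T i)"
    proof
      fix x assume "x \<in> ?S Z"
      then obtain z s t where x: "x = a + t *\<^sub>R (z - a) + s *\<^sub>R n" "z \<in> Z" "norm (z - a) \<le> k" "\<bar>s\<bar> \<le> k" "\<bar>t\<bar> \<le> k"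
        by (elim CollectE exE conjE)
      obtain i where "z \<in> C i" using C(1) x(2) by (elim subsetD[THEN UN_E])
      with x have "x \<in> ?S (C i)" by (intro CollectI exI conjI)
      with T(2) show "x \<in> (\<Union>i. T i)" by (intro UN_I[OF UNIV_I]) (rule subsetD)
    qed
    show "(\<Union>i. T i) \<in> lmeasurable"
    proof (rule fmeasurableI)
      show "(\<Union>i. T i) \<in> sets lebesgue" using T(1) by (intro sets.countable_UN) auto
      show "emeasure lebesgue (\<Union>i. T i) < \<infinity>" using le ennreal_less_top le_less_trans by (metis infinity_ennreal_def)
    qed
    have "measure lebesgue (\<Union>i. T i) \<le> M * (2 * \<epsilon>)"
      unfolding measure_def using enn2real_mono[OF le] M \<epsilon> by simp
    with Me show "measure lebesgue (\<Union>i. T i) < e" by linarith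
  qed
qed

lemma negligible_swept_set:
  fixes Z :: "'a::euclidean_space set"
  assumes "DIM('a) = d + 2" "hausdorff_measure d Z = 0"
  shows "negligible {a + t *\<^sub>R (z - a) + s *\<^sub>R n | z s t. z \<in> Z}" (is "negligible ?E")
proof -
  let ?S = "\<lambda>k::nat. {a + t *\<^sub>R (z - a) + s *\<^sub>R n | z s t. z \<in> Z \<and> norm (z - a) \<le> k \<and> \<bar>s\<bar> \<le> k \<and> \<bar>t\<bar> \<le> k}"
  have "?E \<subseteq> (\<Union>k. ?S k)"
  proof
    fix x assume "x \<in> ?E"
    then obtain z s t where x: "x = a + t *\<^sub>R (z - a) + s *\<^sub>R n" "z \<in> Z" by blast
    obtain k where "max (norm (z - a)) (max \<bar>s\<bar> \<bar>t\<bar>) \<le> real k" using real_arch_simple by blast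
    with x have "x \<in> ?S k" by auto
    then show "x \<in> (\<Union>k. ?S k)" by blast
  qed
  moreover have "negligible (\<Union>k. ?S k)"
    using negligible_swept_set_bounded[OF assms] by (intro negligible_countable_Union) auto
  ultimately show ?thesis using negligible_subset by blast
qed

section \<open>Propagation along rays\<close>

text \<open>The chart is quantified away because successive points of a ray come with different
  charts.\<close>

definition levi_negative_point :: "(complex ^ 'n) set \<Rightarrow> complex ^ 'n \<Rightarrow> bool"
  where "levi_negative_point D b \<longleftrightarrow> b \<in> frontier D \<and>
    (\<exists>U r r' r'' X. C2_chart D U r r' r'' \<and> b \<in> U \<and> levi_negative (r' b) (r'' b) X)"

lemma levi_negative_point_dilation:
  fixes D :: "(complex ^ 'n) set"
  assumes "open D" and exc: "exceptional_point D a" and m: "levi_negative_point D m"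
  shows "\<exists>d>0. \<forall>z t. dist z m < d \<longrightarrow> \<bar>t - 1\<bar> < d \<longrightarrow> (a + t *\<^sub>R (z - a) \<in> D \<longleftrightarrow> z \<in> D)"
proof -
  obtain U r r' r'' X where chart: "C2_chart D U r r' r''" and mU: "m \<in> U"
    and neg: "levi_negative (r' m) (r'' m) X" and mD: "m \<in> frontier D"
    using m unfolding levi_negative_point_def by (elim conjE exE)
  obtain e where e: "0 < e" "\<And>z. dist z m < e \<Longrightarrow> z \<in> U \<and> (\<exists>Y. levi_negative (r' z) (r'' z) Y)"
    using levi_negative_nearby[OF chart mD mU neg] by (elim exE conjE) simp
  show ?thesis
  proof (rule local_dilation_invariance[OF chart mD mU e(1)])
    fix z assume z: "z \<in> frontier D" "dist z m < e"
    then obtain Y where "levi_negative (r' z) (r'' z) Y" using e(2)[OF z(2)] by (elim conjE exE)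
    with z e(2)[OF z(2)] show "r' z (z - a) = 0"
      using exceptional_point_imp_tangential[OF \<open>open D\<close> chart z(1) _ _ exc] by simp
  qed
qed

lemma frontier_germ_scale:
  fixes D :: "'a::real_normed_vector set"
  assumes eq: "\<forall>\<^sub>F v in nhds 0. q + s *\<^sub>R v \<in> D \<longleftrightarrow> p + v \<in> D" and "0 < s" and "p \<in> frontier D"
  shows "q \<in> frontier D"
proof -
  have *: "\<exists>y\<in>A. dist y q < e" if p: "\<forall>e>0. \<exists>y\<in>B. dist y p < e" and "0 < e"
    and AB: "\<forall>\<^sub>F v in nhds 0. p + v \<in> B \<longrightarrow> q + s *\<^sub>R v \<in> A" for A B e
  proof -
    obtain d where d: "0 < d" "\<And>v. norm v < d \<Longrightarrow> p + v \<in> B \<Longrightarrow> q + s *\<^sub>R v \<in> A"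
      using AB by (auto simp: eventually_nhds_metric)
    obtain y where y: "y \<in> B" "dist y p < min d (e / s)" using p d(1) \<open>0 < e\<close> \<open>0 < s\<close> by (meson divide_pos_pos min_less_iff_conj)
    have "q + s *\<^sub>R (y - p) \<in> A" by (rule d(2)) (use y in \<open>auto simp: dist_norm\<close>)
    moreover have "dist (q + s *\<^sub>R (y - p)) q < e"
      using y \<open>0 < s\<close> by (simp add: dist_norm pos_less_divide_eq mult.commute del: scaleR_diff_right)
    ultimately show ?thesis by blast
  qed
  have "p \<in> closure D" "p \<in> closure (- D)"
    using assms(3) by (auto simp: frontier_closures)
  moreover have "\<forall>\<^sub>F v in nhds 0. p + v \<in> D \<longrightarrow> q + s *\<^sub>R v \<in> D"
    "\<forall>\<^sub>F v in nhds 0. p + v \<in> - D \<longrightarrow> q + s *\<^sub>R v \<in> - D"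
    using eq by (auto elim: eventually_mono)
  ultimately have "q \<in> closure D" "q \<in> closure (- D)"
    using *[of D _ D] *[of "- D" _ "- D"] unfolding closure_approachable by blast+
  then show ?thesis by (simp add: frontier_closures)
qed

text \<open>The points \<open>x k\<close> have the germ of \<open>m\<close> scaled by \<open>s k\<close>. Hence the Levi form at \<open>x k\<close>, normalised by
  the gradient, stays bounded away from \<open>0\<close> and its sign survives in the limit.\<close>

lemma levi_negative_along_ray:
  fixes D :: "(complex ^ 'n) set"
  assumes chart: "C2_chart D U r r' r''" and m: "m \<in> frontier D" "m \<in> U"
    and neg: "levi_negative (r' m) (r'' m) X"
    and germ: "\<And>k. \<forall>\<^sub>F v in nhds 0. x k + s k *\<^sub>R v \<in> D \<longleftrightarrow> m + v \<in> D"
    and s: "\<And>k::nat. 0 < s k" "s \<longlonglongrightarrow> s0" "0 < s0" and x: "x \<longlonglongrightarrow> x0"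
    and C2: "C2_smooth_boundary_point D x0"
  shows "levi_negative_point D x0"
proof -
  note c = C2_chartD[OF chart]
  obtain U2 \<rho> where 2: "x0 \<in> frontier D" "C2_defining_function D x0 U2 \<rho>"
    using C2 unfolding C2_smooth_boundary_point_def by blast
  then have x0: "x0 \<in> U2" by (simp add: C2_defining_function_def)
  obtain \<rho>' \<rho>'' where chart2: "C2_chart D U2 \<rho> \<rho>' \<rho>''" using C2_defining_function_imp_chart[OF 2(2)] .
  note c2 = C2_chartD[OF chart2]
  let ?I = "\<i> *s X"
  let ?L = "r'' m X X + r'' m ?I ?I"
  obtain n where n: "0 < r' m n" using blinfun_nonzero_pos[OF c(7)[OF m(2,1)]] by metis
  have X: "r' m X = 0" "r' m ?I = 0" "?L < 0" using neg by (auto simp: levi_negative_def)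
  have in_fr: "x k \<in> frontier D" for k by (rule frontier_germ_scale[OF germ s(1) m(1)])
  have key: "\<exists>cc>0. \<rho>' (x k) = cc *\<^sub>R r' m \<and>
      s k * (\<rho>'' (x k) X X + \<rho>'' (x k) ?I ?I) = cc * ?L" if k: "x k \<in> U2" for k
  proof -
    have "\<forall>\<^sub>F v in nhds 0. m + v \<in> U"
    proof -
      have "((\<lambda>v. m + v) \<longlongrightarrow> m + 0) (nhds 0)" by (intro tendsto_intros filterlim_ident)
      then show ?thesis using topological_tendstoD[OF _ c(1)] m(2) by simp
    qed
    moreover have "\<forall>\<^sub>F v in nhds 0. x k + s k *\<^sub>R v \<in> U2"
    proof -
      have "((\<lambda>v. x k + s k *\<^sub>R v) \<longlongrightarrow> x k + s k *\<^sub>R 0) (nhds 0)" by (intro tendsto_intros filterlim_ident)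
      then show ?thesis using topological_tendstoD[OF _ c2(1)] k by simp
    qed
    ultimately have eqv: "\<forall>\<^sub>F v in nhds 0. r (m + v) < 0 \<longleftrightarrow> \<rho> (x k + s k *\<^sub>R v) < 0"
      using germ[of k] by eventually_elim (simp add: c(5) c2(5))
    have r0: "r m = 0" "\<rho> (x k) = 0" using c(6) c2(6) m k in_fr by auto
    show ?thesis
    proof (rule germ_eq_imp_second_order[OF c(1) m(2) c(2) c(3)[OF m(2)] r0(1) c(7)[OF m(2,1)]
          c2(1) k c2(2) c2(3)[OF k] r0(2) c2(7)[OF k in_fr] eqv s(1)])
      fix cc assume "0 < cc" "\<rho>' (x k) = cc *\<^sub>R r' m"
        and *: "\<And>X. r' m X = 0 \<Longrightarrow> s k * \<rho>'' (x k) X X = cc * r'' m X X"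
      moreover have "s k * (\<rho>'' (x k) X X + \<rho>'' (x k) ?I ?I) = cc * ?L"
        using *[OF X(1)] *[OF X(2)] by (simp add: algebra_simps)
      ultimately show ?thesis by blast
    qed
  qed
  have evU: "\<forall>\<^sub>F k in sequentially. x k \<in> U2" using topological_tendstoD[OF x c2(1)] x0 .
  have lim': "(\<lambda>k. \<rho>' (x k)) \<longlonglongrightarrow> \<rho>' x0" and lim'': "(\<lambda>k. \<rho>'' (x k)) \<longlonglongrightarrow> \<rho>'' x0"
    using isCont_tendsto_compose[OF C2_chart_isCont(2)[OF chart2 x0] x]
      isCont_tendsto_compose[OF C2_chart_isCont(3)[OF chart2 x0] x] by auto
  have zero: "\<rho>' x0 v = 0" if "r' m v = 0" for v
  proof (rule tendsto_unique)
    show "(\<lambda>k. \<rho>' (x k) v) \<longlonglongrightarrow> \<rho>' x0 v" by (intro tendsto_intros lim')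
    show "(\<lambda>k. \<rho>' (x k) v) \<longlonglongrightarrow> 0"
    proof (rule tendsto_eventually)
      show "\<forall>\<^sub>F k in sequentially. \<rho>' (x k) v = 0"
        using evU by eventually_elim (use key that in \<open>force simp: blinfun.bilinear_simps\<close>)
    qed
  qed simp
  have "0 \<le> \<rho>' x0 n"
  proof (rule tendsto_lowerbound)
    show "(\<lambda>k. \<rho>' (x k) n) \<longlonglongrightarrow> \<rho>' x0 n" by (intro tendsto_intros lim')
    show "\<forall>\<^sub>F k in sequentially. 0 \<le> \<rho>' (x k) n"
      using evU by eventually_elim (use key n in \<open>force simp: blinfun.bilinear_simps\<close>)
  qed simp
  \<comment> \<open>The factors \<open>cc\<close> could a priori tend to 0. Then the limit gradient
    would vanish on \<open>n\<close> as well as on the kernel of \<open>r' m\<close>, hence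
    everywhere.\<close>
  moreover have "\<rho>' x0 n \<noteq> 0"
  proof
    assume 0: "\<rho>' x0 n = 0"
    have "\<rho>' x0 w = 0" for w
    proof -
      have "r' m (w - (r' m w / r' m n) *\<^sub>R n) = 0" using n by (simp add: blinfun.bilinear_simps)
      from zero[OF this] 0 show ?thesis by (simp add: blinfun.bilinear_simps)
    qed
    then have "\<rho>' x0 = 0" by (intro blinfun_eqI) simp
    with c2(7)[OF x0 2(1)] show False by simp
  qed
  ultimately have pos: "0 < \<rho>' x0 n" by simp
  \<comment> \<open>Evaluation at \<open>n\<close> expresses \<open>cc\<close> by the gradient as
    \<open>\<rho>' (x k) n / r' m n\<close>, which converges.\<close>
  have "s0 * (\<rho>'' x0 X X + \<rho>'' x0 ?I ?I) = \<rho>' x0 n / r' m n * ?L"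
  proof (rule tendsto_unique)
    show "(\<lambda>k. s k * (\<rho>'' (x k) X X + \<rho>'' (x k) ?I ?I)) \<longlonglongrightarrow> s0 * (\<rho>'' x0 X X + \<rho>'' x0 ?I ?I)"
      by (intro tendsto_intros lim'' s)
    have "(\<lambda>k. \<rho>' (x k) n / r' m n * ?L) \<longlonglongrightarrow> \<rho>' x0 n / r' m n * ?L"
      using n by (intro tendsto_intros lim') auto
    moreover have "\<forall>\<^sub>F k in sequentially. \<rho>' (x k) n / r' m n * ?L = s k * (\<rho>'' (x k) X X + \<rho>'' (x k) ?I ?I)"
      using evU by eventually_elim (use key n in \<open>force simp: blinfun.bilinear_simps\<close>)
    ultimately show "(\<lambda>k. s k * (\<rho>'' (x k) X X + \<rho>'' (x k) ?I ?I)) \<longlonglongrightarrow> \<rho>' x0 n / r' m n * ?L"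
      by (rule Lim_transform_eventually)
  qed simp
  also have "\<dots> < 0" using pos n X(3) by (intro mult_pos_neg divide_pos_pos)
  finally have "\<rho>'' x0 X X + \<rho>'' x0 ?I ?I < 0" using s(3) by (simp add: mult_less_0_iff)
  then have "levi_negative (\<rho>' x0) (\<rho>'' x0) X" using zero X by (simp add: levi_negative_def)
  then show ?thesis unfolding levi_negative_point_def using 2(1) chart2 x0 by blast
qed

text \<open>A connectedness argument on the scales in \<open>{0<..1}\<close> for which the germ on
  the ray is the scaled germ of \<open>m\<close>.\<close>

lemma levi_negative_ray_germ:
  fixes D :: "(complex ^ 'n) set"
  assumes "open D" and exc: "exceptional_point D a" and m: "levi_negative_point D m"
    and ray: "\<And>t. \<lbrakk>0 < t; t \<le> 1; a + t *\<^sub>R (m - a) \<in> frontier D\<rbrakk>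
      \<Longrightarrow> C2_smooth_boundary_point D (a + t *\<^sub>R (m - a))"
    and "0 < s" "s \<le> 1"
  shows "\<forall>\<^sub>F v in nhds 0. a + s *\<^sub>R (m - a) + s *\<^sub>R v \<in> D \<longleftrightarrow> m + v \<in> D"
proof -
  obtain U r r' r'' X where chart: "C2_chart D U r r' r''" and mU: "m \<in> U"
    and neg: "levi_negative (r' m) (r'' m) X" and mD: "m \<in> frontier D"
    using m unfolding levi_negative_point_def by (elim conjE exE)
  define x where "x s = a + s *\<^sub>R (m - a)" for s
  define Q where "Q s \<longleftrightarrow> (\<forall>\<^sub>F v in nhds 0. x s + s *\<^sub>R v \<in> D \<longleftrightarrow> m + v \<in> D)" for s
  define S where "S = {s \<in> {0<..1}. Q s}"
  \<comment> \<open>One statement for both halves of the argument: starting from a point of the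
    closure it yields openness and closedness. That \<open>x s0\<close> is a boundary point comes
    from the limit, and only then does \<open>ray\<close> make it
    \<open>C\<^sup>2\<close>-smooth.\<close>
  have local: "\<exists>\<delta>>0. \<forall>s\<in>{0<..1}. dist s s0 < \<delta> \<longrightarrow> s \<in> S" if s0: "0 < s0" "s0 \<le> 1" "s0 \<in> closure S" for s0
  proof -
    obtain \<sigma> where \<sigma>: "\<And>k. \<sigma> k \<in> S" "\<sigma> \<longlonglongrightarrow> s0" using s0(3) unfolding closure_sequential by blast
    have \<sigma>pos: "0 < \<sigma> k" and germ: "\<forall>\<^sub>F v in nhds 0. x (\<sigma> k) + \<sigma> k *\<^sub>R v \<in> D \<longleftrightarrow> m + v \<in> D" for k
      using \<sigma>(1)[of k] by (auto simp: S_def Q_def)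
    have xlim: "(\<lambda>k. x (\<sigma> k)) \<longlonglongrightarrow> x s0" unfolding x_def by (intro tendsto_intros \<sigma>(2))
    have fr: "x (\<sigma> k) \<in> frontier D" for k by (rule frontier_germ_scale[OF germ \<sigma>pos mD])
    have "x s0 \<in> frontier D" by (rule closed_sequentially[OF frontier_closed fr xlim])
    then have "C2_smooth_boundary_point D (x s0)" using ray[of s0] s0 by (simp add: x_def)
    then have "levi_negative_point D (x s0)"
      by (rule levi_negative_along_ray[OF chart mD mU neg germ \<sigma>pos \<sigma>(2) s0(1) xlim])
    from levi_negative_point_dilation[OF \<open>open D\<close> exc this]
    obtain d where d: "0 < d"
      "\<And>z t. dist z (x s0) < d \<Longrightarrow> \<bar>t - 1\<bar> < d \<Longrightarrow> a + t *\<^sub>R (z - a) \<in> D \<longleftrightarrow> z \<in> D" by blast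
    have "(\<lambda>k. s0 / \<sigma> k) \<longlonglongrightarrow> s0 / s0" using s0 by (intro tendsto_intros \<sigma>(2)) simp
    then have "\<forall>\<^sub>F k in sequentially. dist (s0 / \<sigma> k) (s0 / s0) < d / 2" by (rule tendstoD) (use d in simp)
    moreover have "\<forall>\<^sub>F k in sequentially. dist (x (\<sigma> k)) (x s0) < d / 2"
      using xlim by (rule tendstoD) (use d in simp)
    ultimately have "\<forall>\<^sub>F k in sequentially. dist (s0 / \<sigma> k) (s0 / s0) < d / 2 \<and> dist (x (\<sigma> k)) (x s0) < d / 2"
      by (rule eventually_conj)
    from eventually_happens'[OF sequentially_bot this]
    obtain k where k: "dist (s0 / \<sigma> k) (s0 / s0) < d / 2" "dist (x (\<sigma> k)) (x s0) < d / 2" by blast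
    have k1: "\<bar>s0 / \<sigma> k - 1\<bar> < d / 2" using k(1) s0 by (simp add: dist_real_def)
    show ?thesis
    \<comment> \<open>The dilation from \<open>x (\<sigma> k)\<close> to \<open>x s\<close> has
      factor \<open>s / \<sigma> k\<close>. This radius keeps it within \<open>d\<close> of 1, given
      that \<open>s0 / \<sigma> k\<close> is within \<open>d / 2\<close>.\<close>
    proof (intro exI[of _ "d / 2 * \<sigma> k"] conjI ballI impI)
      show "0 < d / 2 * \<sigma> k" using d \<sigma>pos by simp
      fix s assume s: "s \<in> {0<..1}" "dist s s0 < d / 2 * \<sigma> k"
      have "\<bar>s / \<sigma> k - s0 / \<sigma> k\<bar> < d / 2"
        using s(2) \<sigma>pos[of k] by (simp add: dist_real_def pos_divide_less_eq flip: diff_divide_distrib)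
      then have sk: "\<bar>s / \<sigma> k - 1\<bar> < d" using k1 by linarith
      have "\<forall>\<^sub>F v in nhds 0. dist (x (\<sigma> k) + \<sigma> k *\<^sub>R v) (x s0) < d"
      proof (rule order_tendstoD(2))
        show "((\<lambda>v. dist (x (\<sigma> k) + \<sigma> k *\<^sub>R v) (x s0)) \<longlongrightarrow> dist (x (\<sigma> k) + \<sigma> k *\<^sub>R 0) (x s0)) (nhds 0)"
          by (intro tendsto_intros filterlim_ident)
        show "dist (x (\<sigma> k) + \<sigma> k *\<^sub>R 0) (x s0) < d" using k(2) d(1) by simp
      qed
      then have "\<forall>\<^sub>F v in nhds 0. x s + s *\<^sub>R v \<in> D \<longleftrightarrow> m + v \<in> D"
        using germ[of k]
      proof eventually_elim
        case (elim v)
        have "a + (s / \<sigma> k) *\<^sub>R (x (\<sigma> k) + \<sigma> k *\<^sub>R v - a) = x s + s *\<^sub>R v"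
          using \<sigma>pos[of k] by (simp add: x_def scaleR_add_right)
        with d(2)[OF elim(1) sk] elim(2) show ?case by simp
      qed
      with s(1) show "s \<in> S" by (simp add: S_def Q_def)
    qed
  qed
  have "1 \<in> S" by (simp add: S_def Q_def x_def)
  have "openin (top_of_set {0<..1}) S"
    unfolding openin_euclidean_subtopology_iff
  proof (intro conjI ballI)
    show "S \<subseteq> {0<..1}" by (auto simp: S_def)
    fix s0 assume "s0 \<in> S"
    then show "\<exists>e>0. \<forall>x'\<in>{0<..1}. dist x' s0 < e \<longrightarrow> x' \<in> S"
      using local[of s0] closure_subset[of S] by (auto simp: S_def)
  qed
  moreover have "closedin (top_of_set {0<..1}) S"
    unfolding closedin_limpt
  proof (intro conjI allI impI)
    show "S \<subseteq> {0<..1}" by (auto simp: S_def)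
    fix s0 assume s0: "s0 islimpt S \<and> s0 \<in> {0<..(1::real)}"
    then have "s0 \<in> closure S" by (simp add: closure_def)
    then obtain \<delta> where "0 < \<delta>" "\<And>s. s \<in> {0<..1} \<Longrightarrow> dist s s0 < \<delta> \<Longrightarrow> s \<in> S"
      using local[of s0] s0 by auto
    then show "s0 \<in> S" using s0 by simp
  qed
  moreover have "connected {0<..(1::real)}" by simp
  ultimately have "S = {0<..1}" using \<open>1 \<in> S\<close> unfolding connected_clopen by blast
  then have "s \<in> S" using assms by simp
  then show ?thesis by (simp add: S_def Q_def x_def)
qed

section \<open>Dense families of rays and the contradiction with curvature\<close>

text \<open>Choose \<open>p\<close> near \<open>m\<close> off the null swept set and slide it along
  the transversal \<open>n\<close> to the boundary. If the ray from \<open>a\<close> through the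
  resulting point met \<open>Z\<close> at parameter \<open>t\<close>, then \<open>p\<close> would be
  in the swept set with parameters \<open>1 / t\<close> and \<open>- s\<close>.\<close>

lemma rays_avoiding_null_set_dense:
  fixes D :: "'a::euclidean_space set"
  assumes chart: "C2_chart D U r r' r''" and m: "m \<in> frontier D" "m \<in> U"
    and dim: "DIM('a) = d + 2" and H: "hausdorff_measure d Z = 0" and "0 < e"
  obtains m' where "m' \<in> frontier D" "dist m' m < e" "\<And>t. 0 < t \<Longrightarrow> a + t *\<^sub>R (m' - a) \<notin> Z"
proof -
  note c = C2_chartD[OF chart]
  obtain n where n: "norm n = 1" "0 < r' m n" using blinfun_nonzero_pos[OF c(7)[OF m(2,1)]] .
  obtain \<epsilon> where \<epsilon>: "0 < \<epsilon>" "ball m \<epsilon> \<subseteq> U" using c(1) m(2) open_contains_ball by blast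
  have rm: "r m = 0" using c(6) m by blast
  have "((\<lambda>t. r (m + t *\<^sub>R n)) has_derivative (\<lambda>h. r' m (h *\<^sub>R n))) (at 0)"
    by (rule has_derivative_compose[where f = "\<lambda>t. m + t *\<^sub>R n"])
      (use c(2)[OF m(2)] in \<open>auto intro!: derivative_eq_intros\<close>)
  then have df: "((\<lambda>t. r (m + t *\<^sub>R n)) has_real_derivative r' m n) (at 0)"
    by (simp add: has_field_derivative_def blinfun.scaleR_right mult.commute[of _ "r' m n"])
  obtain d1 where d1: "0 < d1" "\<And>h. 0 < h \<Longrightarrow> h < d1 \<Longrightarrow> 0 < r (m + h *\<^sub>R n)"
    using DERIV_pos_inc_right[OF df n(2)] by (auto simp: rm)
  obtain d2 where d2: "0 < d2" "\<And>h. 0 < h \<Longrightarrow> h < d2 \<Longrightarrow> r (m - h *\<^sub>R n) < 0"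
    using DERIV_pos_inc_left[OF df n(2)] by (auto simp: rm)
  \<comment> \<open>The sign of \<open>r\<close> differs at the two ends
    \<open>m - \<sigma> *\<^sub>R n\<close> and \<open>m + \<sigma> *\<^sub>R n\<close>. By
    continuity the same holds for the parallel segment through every \<open>p\<close> close to
    \<open>m\<close>.\<close>
  define \<sigma> where "\<sigma> = min (min d1 d2) (min \<epsilon> e) / 2"
  have \<sigma>: "0 < \<sigma>" "\<sigma> < d1" "\<sigma> < d2" "\<sigma> \<le> \<epsilon> / 2" "\<sigma> \<le> e / 2"
    using d1 d2 \<epsilon> \<open>0 < e\<close> by (auto simp: \<sigma>_def)
  have inball: "dist (p + s *\<^sub>R n) m < dist p m + \<delta>" if "\<bar>s\<bar> < \<delta>" for p s \<delta>
    using norm_triangle_ineq[of "p - m" "s *\<^sub>R n"] that n by (simp add: dist_norm algebra_simps)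
  have cont: "isCont r x" if "x \<in> U" for x using C2_chart_isCont(1)[OF chart that] .
  have lim: "((\<lambda>p. r (p + s *\<^sub>R n)) \<longlongrightarrow> r (m + s *\<^sub>R n)) (nhds m)" if "\<bar>s\<bar> \<le> \<sigma>" for s
  proof -
    have "m + s *\<^sub>R n \<in> U" using inball[of s \<epsilon> m] that \<sigma> \<epsilon> by (auto simp: dist_commute)
    then have "isCont (\<lambda>p. r (p + s *\<^sub>R n)) m"
      by (intro isCont_o2[where g = r and f = "\<lambda>p. p + s *\<^sub>R n", OF _ cont]) auto
    then show ?thesis
      using tendsto_at_iff_tendsto_nhds[of "\<lambda>p. r (p + s *\<^sub>R n)" m] by (simp add: isCont_def)
  qed
  have "\<forall>\<^sub>F p in nhds m. 0 < r (p + \<sigma> *\<^sub>R n)"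
    by (rule order_tendstoD(1)[OF lim]) (use \<sigma> d1(2)[of \<sigma>] in auto)
  moreover have "\<forall>\<^sub>F p in nhds m. r (p + (- \<sigma>) *\<^sub>R n) < 0"
    by (rule order_tendstoD(2)[OF lim]) (use \<sigma> d2(2)[of \<sigma>] in auto)
  ultimately have "\<forall>\<^sub>F p in nhds m. 0 < r (p + \<sigma> *\<^sub>R n) \<and> r (p + (- \<sigma>) *\<^sub>R n) < 0"
    by (rule eventually_conj)
  then obtain \<tau>0 where \<tau>0: "0 < \<tau>0"
    "\<And>p. dist p m < \<tau>0 \<Longrightarrow> 0 < r (p + \<sigma> *\<^sub>R n) \<and> r (p + (- \<sigma>) *\<^sub>R n) < 0"
    unfolding eventually_nhds_metric by blast
  define \<tau> where "\<tau> = min \<tau>0 (\<sigma> / 2)"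
  have \<tau>: "0 < \<tau>" using \<tau>0 \<sigma> by (simp add: \<tau>_def)
  let ?E = "{a + t *\<^sub>R (z - a) + s *\<^sub>R n | z s t. z \<in> Z}"
  have "\<not> ball m \<tau> \<subseteq> ?E"
  proof
    assume "ball m \<tau> \<subseteq> ?E"
    from negligible_subset[OF negligible_swept_set[OF dim H] this]
    show False using open_not_negligible[OF open_ball, of m \<tau>] \<tau> by simp
  qed
  then obtain p where "p \<in> ball m \<tau>" and pE: "p \<notin> ?E" by (meson subsetI)
  then have p: "dist p m < \<tau>" by (simp add: dist_commute)
  have pU: "p + s *\<^sub>R n \<in> U" "dist (p + s *\<^sub>R n) m < e" if "\<bar>s\<bar> \<le> \<sigma>" for s
  proof -
    have "dist (p + s *\<^sub>R n) m < dist p m + 3 / 2 * \<sigma>" by (rule inball) (use that \<sigma> in simp)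
    then have "dist (p + s *\<^sub>R n) m < 2 * \<sigma>" using p by (simp add: \<tau>_def)
    then show "p + s *\<^sub>R n \<in> U" "dist (p + s *\<^sub>R n) m < e" using \<sigma> \<epsilon> by (auto simp: dist_commute)
  qed
  have ends: "r (p + (- \<sigma>) *\<^sub>R n) \<le> 0" "0 \<le> r (p + \<sigma> *\<^sub>R n)" "- \<sigma> \<le> \<sigma>"
    using \<tau>0(2)[of p] p \<sigma>(1) by (auto simp: \<tau>_def)
  have "continuous_on {- \<sigma>..\<sigma>} (\<lambda>s. r (p + s *\<^sub>R n))"
  proof (intro continuous_at_imp_continuous_on ballI)
    fix s assume "s \<in> {- \<sigma>..\<sigma>}"
    then have "p + s *\<^sub>R n \<in> U" by (intro pU) auto
    then show "isCont (\<lambda>s. r (p + s *\<^sub>R n)) s"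
      by (intro isCont_o2[where g = r and f = "\<lambda>s. p + s *\<^sub>R n", OF _ cont]) auto
  qed
  from IVT'[of "\<lambda>s. r (p + s *\<^sub>R n)", OF ends this]
  obtain s where s: "- \<sigma> \<le> s" "s \<le> \<sigma>" "r (p + s *\<^sub>R n) = 0" by (elim exE conjE)
  then have s': "\<bar>s\<bar> \<le> \<sigma>" by simp
  show thesis
  proof (rule that)
    show "p + s *\<^sub>R n \<in> frontier D" using c(6)[OF pU(1)[OF s']] s(3) by simp
    show "dist (p + s *\<^sub>R n) m < e" by (rule pU(2)[OF s'])
    fix t :: real assume "0 < t"
    show "a + t *\<^sub>R (p + s *\<^sub>R n - a) \<notin> Z"
    proof
      assume z: "a + t *\<^sub>R (p + s *\<^sub>R n - a) \<in> Z"
      have "p = a + (1 / t) *\<^sub>R ((a + t *\<^sub>R (p + s *\<^sub>R n - a)) - a) + (- s) *\<^sub>R n"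
        using \<open>0 < t\<close> by simp
      with z pE show False by blast
    qed
  qed
qed

text \<open>The parabolas \<open>b \<plusminus> t Y + k t\<^sup>2 n\<close> with \<open>k\<close> between \<open>0\<close> and a large constant cross the boundary
  on both sides; a hyperplane containing both crossing points would have to contain the
  direction \<open>n\<close>.\<close>

lemma frontier_not_in_hyperplane:
  fixes D :: "'a::euclidean_space set"
  assumes chart: "C2_chart D U r r' r''" and b: "b \<in> frontier D" "b \<in> U"
    and Y: "r' b Y = 0" "r'' b Y Y < 0" and "g \<noteq> 0" "0 < e"
  shows "\<exists>m\<in>frontier D. dist m b < e \<and> (m - b) \<bullet> g \<noteq> 0"
proof (rule ccontr)
  assume contr: "\<not> ?thesis"
  note c = C2_chartD[OF chart]
  have rb: "r b = 0" using c(6) b by blast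
  obtain n0 where n0: "0 < r' b n0" using blinfun_nonzero_pos[OF c(7)[OF b(2,1)]] by metis
  obtain n where n: "0 < r' b n" "n \<bullet> g \<noteq> 0"
  proof (cases "n0 \<bullet> g = 0")
    case True
    \<comment> \<open>If the transversal vector is orthogonal to \<open>g\<close>, it is tilted
      towards \<open>g\<close>, by so little that \<open>r' b\<close> stays positive on it.\<close>
    define \<mu> where "\<mu> = r' b n0 / (2 * (\<bar>r' b g\<bar> + 1))"
    have \<mu>: "0 < \<mu>" using n0 by (simp add: \<mu>_def add_nonneg_pos)
    have "\<mu> * \<bar>r' b g\<bar> \<le> \<mu> * (\<bar>r' b g\<bar> + 1)" using \<mu> by simp
    also have "\<dots> = r' b n0 / 2" by (simp add: \<mu>_def field_simps add_nonneg_eq_0_iff)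
    finally have "\<mu> * \<bar>r' b g\<bar> < r' b n0" using n0 by simp
    then have "0 < r' b n0 + \<mu> * r' b g"
      using abs_ge_minus_self[of "\<mu> * r' b g"] \<mu> by (simp add: abs_mult)
    then show ?thesis
      using that[of "n0 + \<mu> *\<^sub>R g"] \<mu> True \<open>g \<noteq> 0\<close> by (simp add: blinfun.bilinear_simps inner_simps)
  qed (use n0 that in blast)
  \<comment> \<open>With this coefficient the limit of \<open>r (p t k) / t\<^sup>2\<close> is 1,
    while for coefficient 0 it is negative.\<close>
  define k where "k = (1 - r'' b Y Y / 2) / r' b n"
  have k: "0 < k" "k * r' b n = 1 - r'' b Y Y / 2" using n Y by (auto simp: k_def)
  define p where "p t \<kappa> = b + (t *\<^sub>R Y + (\<kappa> * t\<^sup>2) *\<^sub>R n)" for t \<kappa>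
  have "((\<lambda>t. r (p t 0) / t\<^sup>2) \<longlongrightarrow> r'' b Y Y / 2 + 0 * r' b n) (at 0)"
    unfolding p_def by (rule parabola_expansion[OF c(1) b(2) c(2) c(3)[OF b(2)] rb Y(1)])
  then have "\<forall>\<^sub>F t in at 0. r (p t 0) / t\<^sup>2 < 0" by (rule order_tendstoD) (use Y in simp)
  moreover have "((\<lambda>t. r (p t k) / t\<^sup>2) \<longlongrightarrow> r'' b Y Y / 2 + k * r' b n) (at 0)"
    unfolding p_def by (rule parabola_expansion[OF c(1) b(2) c(2) c(3)[OF b(2)] rb Y(1)])
  then have "\<forall>\<^sub>F t in at 0. 0 < r (p t k) / t\<^sup>2" by (rule order_tendstoD) (use k in simp)
  moreover obtain \<epsilon> where \<epsilon>: "0 < \<epsilon>" "ball b \<epsilon> \<subseteq> U" using c(1) b(2) open_contains_ball by blast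
  have "((\<lambda>t. \<bar>t\<bar> * norm Y + k * t\<^sup>2 * norm n) \<longlongrightarrow> \<bar>0\<bar> * norm Y + k * 0\<^sup>2 * norm n) (at 0)"
    by (intro tendsto_intros)
  then have "\<forall>\<^sub>F t in at 0. \<bar>t\<bar> * norm Y + k * t\<^sup>2 * norm n < min \<epsilon> e"
    by (rule order_tendstoD) (use \<epsilon> \<open>0 < e\<close> in simp)
  ultimately have "\<forall>\<^sub>F t in at 0. r (p t 0) / t\<^sup>2 < 0 \<and> 0 < r (p t k) / t\<^sup>2 \<and>
      \<bar>t\<bar> * norm Y + k * t\<^sup>2 * norm n < min \<epsilon> e"
    by eventually_elim simp
  then obtain d where d: "0 < d" "\<And>t. t \<noteq> 0 \<Longrightarrow> \<bar>t\<bar> < d \<Longrightarrow> r (p t 0) / t\<^sup>2 < 0 \<and> 0 < r (p t k) / t\<^sup>2 \<and>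
      \<bar>t\<bar> * norm Y + k * t\<^sup>2 * norm n < min \<epsilon> e"
    unfolding eventually_at by (auto simp: dist_real_def)
  have cross: "\<exists>\<kappa>>0. t * (Y \<bullet> g) + \<kappa> * t\<^sup>2 * (n \<bullet> g) = 0" if t: "t \<noteq> 0" "\<bar>t\<bar> < d" for t
  proof -
    have neg: "r (p t 0) < 0" and pos: "0 < r (p t k)" and small: "\<bar>t\<bar> * norm Y + k * t\<^sup>2 * norm n < min \<epsilon> e"
      using d(2)[OF t] t by (auto simp: divide_less_0_iff zero_less_divide_iff not_less[symmetric])
    have near: "dist (p t \<kappa>) b < min \<epsilon> e" if "0 \<le> \<kappa>" "\<kappa> \<le> k" for \<kappa>
    proof -
      have "dist (p t \<kappa>) b = norm (t *\<^sub>R Y + (\<kappa> * t\<^sup>2) *\<^sub>R n)" by (simp add: p_def dist_norm)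
      also have "\<dots> \<le> \<bar>t\<bar> * norm Y + k * t\<^sup>2 * norm n"
        using that by (intro norm_triangle_le add_mono) (auto simp: abs_mult intro!: mult_right_mono)
      finally show ?thesis using small by simp
    qed
    have inU: "p t \<kappa> \<in> U" if "0 \<le> \<kappa>" "\<kappa> \<le> k" for \<kappa> using near[OF that] \<epsilon> by (auto simp: dist_commute)
    have "continuous_on {0..k} (\<lambda>\<kappa>. r (p t \<kappa>))"
    proof (intro continuous_at_imp_continuous_on ballI)
      fix \<kappa> assume "\<kappa> \<in> {0..k}"
      then have r: "isCont r (p t \<kappa>)" using C2_chart_isCont(1)[OF chart inU] by simp
      have "isCont (p t) \<kappa>" unfolding p_def[abs_def] by (intro continuous_intros)
      from isCont_o2[OF this r] show "isCont (\<lambda>\<kappa>. r (p t \<kappa>)) \<kappa>" .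
    qed
    from IVT'[OF less_imp_le[OF neg] less_imp_le[OF pos] less_imp_le[OF k(1)] this]
    obtain \<kappa> where \<kappa>: "0 \<le> \<kappa>" "\<kappa> \<le> k" "r (p t \<kappa>) = 0" by (elim exE conjE)
    then have "\<kappa> \<noteq> 0" using neg by auto
    have "p t \<kappa> \<in> frontier D" using c(6)[OF inU[OF \<kappa>(1,2)]] \<kappa>(3) by simp
    then have "(p t \<kappa> - b) \<bullet> g = 0" using contr near[OF \<kappa>(1,2)] by auto
    then show ?thesis using \<kappa>(1) \<open>\<kappa> \<noteq> 0\<close> by (intro exI[of _ \<kappa>]) (simp add: p_def inner_simps)
  qed
  \<comment> \<open>For opposite values of \<open>t\<close> the linear terms cancel in the sum and
    only the direction \<open>n\<close> remains.\<close>
  obtain \<kappa>1 where \<kappa>1: "0 < \<kappa>1" "d / 2 * (Y \<bullet> g) + \<kappa>1 * (d / 2)\<^sup>2 * (n \<bullet> g) = 0"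
    using cross[of "d / 2"] d(1) by auto
  obtain \<kappa>2 where \<kappa>2: "0 < \<kappa>2" "- (d / 2) * (Y \<bullet> g) + \<kappa>2 * (- (d / 2))\<^sup>2 * (n \<bullet> g) = 0"
    using cross[of "- (d / 2)"] d(1) by auto
  have "(\<kappa>1 + \<kappa>2) * (d / 2)\<^sup>2 * (n \<bullet> g) = 0" using \<kappa>1(2) \<kappa>2(2) by (simp add: algebra_simps)
  then show False using \<kappa>1(1) \<kappa>2(1) d(1) n(2) by simp
qed

theorem theorem6:
  fixes D :: "(complex ^ 'n) set"
  assumes "open D"
    and "C1_smooth D"
    and "\<exists>b. C2_smooth_boundary_point D b \<and> non_pseudoconvex_boundary_point D b"
    and "hausdorff_measure (2 * CARD('n) - 2) {b \<in> frontier D. \<not> C2_smooth_boundary_point D b} = 0"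
  shows "\<not> (\<exists>a. exceptional_point D a)"
proof
  assume "\<exists>a. exceptional_point D a"
  then obtain a where exc: "exceptional_point D a" ..
  define Z where "Z = {b \<in> frontier D. \<not> C2_smooth_boundary_point D b}"
  obtain b where "non_pseudoconvex_boundary_point D b" using assms(3) by blast
  then obtain U r r' r'' X where chart: "C2_chart D U r r' r''" and b: "b \<in> frontier D" "b \<in> U"
    and neg: "levi_negative (r' b) (r'' b) X"
    by (rule non_pseudoconvex_imp_levi_negative)
  obtain e where e: "0 < e" "\<And>z. dist z b < e \<Longrightarrow> z \<in> U \<and> (\<exists>Y. levi_negative (r' z) (r'' z) Y)"
    using levi_negative_nearby[OF chart b neg] by blast
  have dim: "DIM(complex ^ 'n) = (2 * CARD('n) - 2) + 2"
  proof -
    have "0 < CARD('n)" by simp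
    then show ?thesis by (cases "CARD('n)") auto
  qed
  have ray: "\<exists>m'. dist m' m < \<epsilon> \<and> (\<forall>s. 0 < s \<longrightarrow> s \<le> 1 \<longrightarrow> a + s *\<^sub>R (m' - a) \<in> frontier D)"
    if m: "m \<in> frontier D" "dist m b < e" and "0 < \<epsilon>" for m \<epsilon>
  proof -
    \<comment> \<open>The second bound keeps \<open>m'\<close> in the neighbourhood of
      \<open>b\<close> where the Levi form is negative.\<close>
    define \<epsilon>' where "\<epsilon>' = min \<epsilon> (e - dist m b)"
    have "0 < \<epsilon>'" using m \<open>0 < \<epsilon>\<close> by (simp add: \<epsilon>'_def)
    obtain m' where m': "m' \<in> frontier D" "dist m' m < \<epsilon>'" "\<And>t. 0 < t \<Longrightarrow> a + t *\<^sub>R (m' - a) \<notin> Z"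
      using rays_avoiding_null_set_dense[OF chart m(1) conjunct1[OF e(2)[OF m(2)]] dim
          assms(4)[folded Z_def] \<open>0 < \<epsilon>'\<close>] by blast
    have "dist m' b < e" using dist_triangle[of m' b m] m'(2) by (simp add: \<epsilon>'_def)
    then have lev: "levi_negative_point D m'"
      using e(2)[of m'] m'(1) chart unfolding levi_negative_point_def by blast
    have "a + s *\<^sub>R (m' - a) \<in> frontier D" if s: "0 < s" "s \<le> 1" for s
    proof (rule frontier_germ_scale[OF levi_negative_ray_germ[OF \<open>open D\<close> exc lev _ s] s(1) m'(1)])
      show "C2_smooth_boundary_point D (a + t *\<^sub>R (m' - a))"
        if "0 < t" "t \<le> 1" "a + t *\<^sub>R (m' - a) \<in> frontier D" for t
        using m'(3)[OF that(1)] that(3) by (simp add: Z_def)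
    qed
    then show ?thesis using m'(2) by (auto simp: \<epsilon>'_def)
  qed
  have lim: "((\<lambda>s. a + s *\<^sub>R (m' - a)) \<longlongrightarrow> a) (at_right 0)" for m'
    by (auto intro!: tendsto_eq_intros)
  have "a \<in> frontier D"
  proof -
    obtain m' where "\<And>s. 0 < s \<Longrightarrow> s \<le> 1 \<Longrightarrow> a + s *\<^sub>R (m' - a) \<in> frontier D"
      using ray[of b 1] b e by auto
    then have "\<forall>\<^sub>F s in at_right 0. a + s *\<^sub>R (m' - a) \<in> frontier D"
      by (intro eventually_at_rightI[of 0 1]) auto
    then show ?thesis using Lim_in_closed_set[OF frontier_closed _ _ lim] by simp
  qed
  then obtain V \<sigma> where "C1_defining_function D a V \<sigma>"
    using \<open>C1_smooth D\<close> unfolding C1_smooth_def C1_smooth_boundary_point_def by blast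
  then have V: "open V" "a \<in> V" and df: "defining_function D V \<sigma>"
    by (auto simp: C1_defining_function_def)
  obtain g where g: "GDERIV \<sigma> a :> g" "g \<noteq> 0"
    using df V(2) \<open>a \<in> frontier D\<close> unfolding defining_function_def by blast
  have \<sigma>0: "z \<in> frontier D \<longleftrightarrow> \<sigma> z = 0" if "z \<in> V" for z
    using df that unfolding defining_function_def by blast
  have ray_tangent: "(m' - a) \<bullet> g = 0"
    if m': "\<And>s. 0 < s \<Longrightarrow> s \<le> 1 \<Longrightarrow> a + s *\<^sub>R (m' - a) \<in> frontier D" for m'
  proof -
    have "((\<lambda>s. \<sigma> (a + s *\<^sub>R (m' - a))) has_derivative (\<lambda>h. (h *\<^sub>R (m' - a)) \<bullet> g)) (at 0)"
      by (rule has_derivative_compose[where f = "\<lambda>s. a + s *\<^sub>R (m' - a)"])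
        (use g(1) in \<open>auto simp: gderiv_def intro!: derivative_eq_intros\<close>)
    then have "((\<lambda>s. \<sigma> (a + s *\<^sub>R (m' - a))) has_real_derivative (m' - a) \<bullet> g) (at 0)"
      by (simp add: has_field_derivative_def mult.commute[of _ "(m' - a) \<bullet> g"])
    then have "((\<lambda>s. \<sigma> (a + s *\<^sub>R (m' - a)) / s) \<longlongrightarrow> (m' - a) \<bullet> g) (at 0)"
      using \<sigma>0[OF V(2)] \<open>a \<in> frontier D\<close> by (simp add: DERIV_def)
    then have "((\<lambda>s. \<sigma> (a + s *\<^sub>R (m' - a)) / s) \<longlongrightarrow> (m' - a) \<bullet> g) (at_right 0)"
      by (rule filterlim_mono) (auto simp: at_le)
    moreover have "\<forall>\<^sub>F s in at_right 0. \<sigma> (a + s *\<^sub>R (m' - a)) / s = 0"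
    proof -
      have "\<forall>\<^sub>F s in at_right 0. a + s *\<^sub>R (m' - a) \<in> frontier D"
        using m' by (intro eventually_at_rightI[of 0 1]) auto
      with topological_tendstoD[OF lim[of m'] V] show ?thesis
        by eventually_elim (use \<sigma>0 in simp)
    qed
    ultimately show ?thesis using tendsto_unique[OF _ _ tendsto_eventually] by force
  qed
  have tangent: "(m - a) \<bullet> g = 0" if m: "m \<in> frontier D" "dist m b < e" for m
  proof -
    \<comment> \<open>The endpoints of the good segments are only dense near \<open>b\<close>;
      closedness of the hyperplane extends the relation to all boundary points there.\<close>
    have "closed {x. (x - a) \<bullet> g = 0}" by (intro closed_Collect_eq continuous_intros)
    moreover have "m \<in> closure {x. (x - a) \<bullet> g = 0}"
      unfolding closure_approachable using ray[OF m] ray_tangent by blast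
    ultimately show ?thesis by simp
  qed
  \<comment> \<open>A negative Levi sum makes one of the real tangent directions \<open>X\<close>
    and \<open>\<i> *s X\<close> negative for the real second derivative, which is all that the
    parabolas need.\<close>
  have "r'' b X X < 0 \<or> r'' b (\<i> *s X) (\<i> *s X) < 0" using neg by (auto simp: levi_negative_def)
  then obtain Y where Y: "r' b Y = 0" "r'' b Y Y < 0" using neg unfolding levi_negative_def by blast
  obtain m where m: "m \<in> frontier D" "dist m b < e" "(m - b) \<bullet> g \<noteq> 0"
    using frontier_not_in_hyperplane[OF chart b Y g(2) e(1)] by blast
  then show False using tangent[OF m(1,2)] tangent[OF b(1)] e(1) by (simp add: inner_diff_left)
qed

end
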